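(* Let $T \colon E \longrightarrow F$ be an operator from a Banach lattice $E$ to a Banach space $F$. (a) If $T$ fails to be order weakly compact, then the set of order bounded weakly null sequences $(x_j)_{j=1}^\infty$ in $E$ such that $(T(x_j))_{j=1}^\infty$ does not converge to $0$ in norm in $F$ is almost positive pointwise latticeable in $\ell_\infty(E)$. (b) If $T$ fails to be almost Dunford-Pettis, then the set of disjoint weakly null sequences $(x_j)_{j=1}^\infty$ in $E$ such that $(T(x_j))_{j=1}^\infty$ does not converge to $0$ in norm in $F$ is almost positive pointwise latticeable in $\ell_\infty(E)$.
   Context: Banach lattices are real; operators are bounded and linear. An operator $T \colon E \to F$ from a Banach lattice $E$ to a Banach space $F$ is order weakly compact if $T([0,x])$ is relatively weakly compact in $F$ for every $x \in E^+$ (the positive cone of $E$); it is almost Dunford-Pettis if $T$ maps disjoint weakly null sequences in $E$ to norm null sequences in $F$. A sequence $(x_j)_{j=1}^\infty$ in $E$ is disjoint if $|x_j| \wedge |x_k| = 0$ for $j \neq k$, and order bounded if there are $a,b \in E$ with $a \leq x_j \leq b$ for every $j$. $\ell_\infty(E)$ is the Banach lattice of bounded $E$-valued sequences with the supremum norm and the pointwise ordering; $X^+$ denotes the positive cone of a Banach lattice $X$. A Banach sequence lattice is a linear subspace $X$ of $E^{\mathbb{N}}$, $E$ a Banach lattice, endowed with a complete norm that makes $X$ a Banach lattice with the pointwise ordering. A subset $B$ of a Banach sequence lattice $X$ with $B \cap X^+ \neq \emptyset$ is almost positive pointwise latticeable (in $X$) if for each positive sequence $\mathbf{x} \in B$ there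 exists a closed infinite dimensional sublattice of $X$ contained in $B \cup \{0\}$ and containing a subsequence of $\mathbf{x}$. *)

theory Defs
  imports
    "HOL-Analysis.Analysis"
    "HOL-Library.Lattice_Algebras"
    "HOL-Library.Function_Algebras"
begin

section \<open>Banach lattices\<close>

text \<open>The superclass \<^class>\<open>lattice_ab_group_add_abs\<close> makes \<open>\<bar>x\<bar>\<close> the lattice modulus \<open>sup x (- x)\<close>.\<close>

class banach_lattice = banach + ordered_real_vector + lattice_ab_group_add_abs +
  assumes norm_mono_modulus: "\<bar>x\<bar> \<le> \<bar>y\<bar> \<Longrightarrow> norm x \<le> norm y"

instance real :: banach_lattice
  by standard simp

text \<open>Coordinatewise scalar multiplication; with the instances of \<^theory>\<open>HOL-Library.Function_Algebras\<close>
  the sequence space \<open>nat \<Rightarrow> 'e\<close> becomes a real vector space, so that \<^const>\<open>subspace\<close> and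
  \<^const>\<open>span\<close> apply. Its order is the pointwise one.\<close>

instantiation "fun" :: (type, real_vector) real_vector
begin

definition scaleR_fun_def: "scaleR c f = (\<lambda>x. c *\<^sub>R f x)"

instance
  by standard (auto simp: scaleR_fun_def fun_eq_iff scaleR_add_right scaleR_add_left)

end


section \<open>Weak topology\<close>

definition weak_topology :: "'a::real_normed_vector topology" where
  "weak_topology =
     topology_generated_by {\<phi> -` U | (\<phi> :: 'a \<Rightarrow> real) U. bounded_linear \<phi> \<and> open U}"

definition relatively_weakly_compact :: "'a::real_normed_vector set \<Rightarrow> bool" where
  "relatively_weakly_compact S \<longleftrightarrow> compactin weak_topology (weak_topology closure_of S)"

definition weakly_null :: "(nat \<Rightarrow> 'a::real_normed_vector) \<Rightarrow> bool" where
  "weakly_null x \<longleftrightarrow> limitin weak_topology x 0 sequentially"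


section \<open>Sequences and operators\<close>

definition disjoint_seq :: "(nat \<Rightarrow> 'e::banach_lattice) \<Rightarrow> bool" where
  "disjoint_seq x \<longleftrightarrow> (\<forall>j k. j \<noteq> k \<longrightarrow> inf \<bar>x j\<bar> \<bar>x k\<bar> = 0)"

definition order_bounded_seq :: "(nat \<Rightarrow> 'e::banach_lattice) \<Rightarrow> bool" where
  "order_bounded_seq x \<longleftrightarrow> (\<exists>a b. \<forall>j. a \<le> x j \<and> x j \<le> b)"

definition order_weakly_compact :: "('e::banach_lattice \<Rightarrow> 'f::banach) \<Rightarrow> bool" where
  "order_weakly_compact T \<longleftrightarrow> (\<forall>x\<ge>0. relatively_weakly_compact (T ` {0..x}))"

definition almost_Dunford_Pettis :: "('e::banach_lattice \<Rightarrow> 'f::banach) \<Rightarrow> bool" where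
  "almost_Dunford_Pettis T \<longleftrightarrow>
     (\<forall>x. disjoint_seq x \<and> weakly_null x \<longrightarrow> (\<lambda>j. T (x j)) \<longlonglongrightarrow> 0)"


section \<open>Banach sequence lattices\<close>

text \<open>A sequence space is given by its carrier \<open>X\<close> and its norm \<open>N\<close>, which is relevant on \<open>X\<close> only.
  The lattice operations are those of the ordered set \<open>X\<close>: for an arbitrary \<open>X\<close>, suprema
  formed in \<open>X\<close> need not be the coordinatewise ones.\<close>

definition is_sup_in :: "'a::order set \<Rightarrow> 'a \<Rightarrow> 'a \<Rightarrow> 'a \<Rightarrow> bool" where
  "is_sup_in X x y z \<longleftrightarrow>
     z \<in> X \<and> x \<le> z \<and> y \<le> z \<and> (\<forall>w\<in>X. x \<le> w \<and> y \<le> w \<longrightarrow> z \<le> w)"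

definition is_inf_in :: "'a::order set \<Rightarrow> 'a \<Rightarrow> 'a \<Rightarrow> 'a \<Rightarrow> bool" where
  "is_inf_in X x y z \<longleftrightarrow>
     z \<in> X \<and> z \<le> x \<and> z \<le> y \<and> (\<forall>w\<in>X. w \<le> x \<and> w \<le> y \<longrightarrow> w \<le> z)"

definition sup_in :: "'a::order set \<Rightarrow> 'a \<Rightarrow> 'a \<Rightarrow> 'a" where
  "sup_in X x y = (THE z. is_sup_in X x y z)"

definition inf_in :: "'a::order set \<Rightarrow> 'a \<Rightarrow> 'a \<Rightarrow> 'a" where
  "inf_in X x y = (THE z. is_inf_in X x y z)"

definition norm_on :: "'a::real_vector set \<Rightarrow> ('a \<Rightarrow> real) \<Rightarrow> bool" where
  "norm_on X N \<longleftrightarrow>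
     (\<forall>x\<in>X. 0 \<le> N x \<and> (N x = 0 \<longleftrightarrow> x = 0)) \<and>
     (\<forall>c. \<forall>x\<in>X. N (c *\<^sub>R x) = \<bar>c\<bar> * N x) \<and>
     (\<forall>x\<in>X. \<forall>y\<in>X. N (x + y) \<le> N x + N y)"

text \<open>\<^locale>\<open>Metric_space\<close> wants nonnegativity and symmetry also off the carrier, hence the case distinction.\<close>

definition norm_dist_on :: "'a::real_vector set \<Rightarrow> ('a \<Rightarrow> real) \<Rightarrow> 'a \<Rightarrow> 'a \<Rightarrow> real" where
  "norm_dist_on X N x y = (if x \<in> X \<and> y \<in> X then N (x - y) else 0)"

definition banach_sequence_lattice ::
    "(nat \<Rightarrow> 'e::banach_lattice) set \<Rightarrow> ((nat \<Rightarrow> 'e) \<Rightarrow> real) \<Rightarrow> bool" where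
  "banach_sequence_lattice X N \<longleftrightarrow>
     subspace X \<and> norm_on X N \<and>
     Metric_space.mcomplete X (norm_dist_on X N) \<and>
     (\<forall>x\<in>X. \<forall>y\<in>X. (\<exists>z. is_sup_in X x y z) \<and> (\<exists>z. is_inf_in X x y z)) \<and>
     (\<forall>x\<in>X. \<forall>y\<in>X. sup_in X x (- x) \<le> sup_in X y (- y) \<longrightarrow> N x \<le> N y)"

definition closed_sublattice_of ::
    "(nat \<Rightarrow> 'e::banach_lattice) set \<Rightarrow> ((nat \<Rightarrow> 'e) \<Rightarrow> real) \<Rightarrow> (nat \<Rightarrow> 'e) set \<Rightarrow> bool" where
  "closed_sublattice_of X N S \<longleftrightarrow>
     S \<subseteq> X \<and> subspace S \<and>
     (\<forall>x\<in>S. \<forall>y\<in>S. sup_in X x y \<in> S \<and> inf_in X x y \<in> S) \<and>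
     closedin (Metric_space.mtopology X (norm_dist_on X N)) S"

definition infinite_dimensional :: "'a::real_vector set \<Rightarrow> bool" where
  "infinite_dimensional S \<longleftrightarrow> \<not> (\<exists>A. finite A \<and> span A = S)"

definition almost_positive_pointwise_latticeable ::
    "(nat \<Rightarrow> 'e::banach_lattice) set \<Rightarrow> ((nat \<Rightarrow> 'e) \<Rightarrow> real) \<Rightarrow> (nat \<Rightarrow> 'e) set \<Rightarrow> bool" where
  "almost_positive_pointwise_latticeable X N B \<longleftrightarrow>
     banach_sequence_lattice X N \<and> B \<subseteq> X \<and> B \<inter> {x \<in> X. 0 \<le> x} \<noteq> {} \<and>
     (\<forall>x\<in>B. 0 \<le> x \<longrightarrow>
        (\<exists>S. closed_sublattice_of X N S \<and> infinite_dimensional S \<and> S \<subseteq> B \<union> {0} \<and>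
             (\<exists>r::nat \<Rightarrow> nat. strict_mono r \<and> x \<circ> r \<in> S)))"

definition ell_infty :: "(nat \<Rightarrow> 'e::banach_lattice) set" where
  "ell_infty = {x. bounded (range x)}"

definition ell_infty_norm :: "(nat \<Rightarrow> 'e::banach_lattice) \<Rightarrow> real" where
  "ell_infty_norm x = (SUP j. norm (x j))"

lemma norm_le_ell_infty_norm: "x \<in> ell_infty \<Longrightarrow> norm (x j) \<le> ell_infty_norm x"
  unfolding ell_infty_def ell_infty_norm_def
  by (auto intro!: cSUP_upper bdd_aboveI2 simp: bounded_iff)

lemma ell_infty_norm_le: "(\<And>j. norm (x j) \<le> C) \<Longrightarrow> ell_infty_norm x \<le> C"
  unfolding ell_infty_norm_def by (intro cSUP_least) auto

lemma norm_abs_eq: "norm \<bar>x\<bar> = norm (x::'e::banach_lattice)"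
  by (intro antisym norm_mono_modulus) simp_all

lemma subspace_ell_infty: "subspace (ell_infty :: (nat \<Rightarrow> 'e::banach_lattice) set)"
  unfolding subspace_def
proof (intro conjI ballI allI)
  show "(0::nat \<Rightarrow> 'e) \<in> ell_infty"
    by (auto simp: ell_infty_def bounded_iff)
next
  fix x y :: "nat \<Rightarrow> 'e" assume "x \<in> ell_infty" "y \<in> ell_infty"
  then obtain a b where "\<And>j. norm (x j) \<le> a" "\<And>j. norm (y j) \<le> b"
    by (auto simp: ell_infty_def bounded_iff)
  then have "norm ((x + y) j) \<le> a + b" for j
    by (simp add: norm_triangle_mono)
  then show "x + y \<in> ell_infty"
    unfolding ell_infty_def bounded_iff by blast
next
  fix c :: real and x :: "nat \<Rightarrow> 'e" assume "x \<in> ell_infty"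
  then obtain a where "\<And>j. norm (x j) \<le> a"
    by (auto simp: ell_infty_def bounded_iff)
  then have "norm ((c *\<^sub>R x) j) \<le> \<bar>c\<bar> * a" for j
    by (simp add: scaleR_fun_def mult_left_mono)
  then show "c *\<^sub>R x \<in> ell_infty"
    unfolding ell_infty_def bounded_iff by blast
qed

lemma abs_ell_infty: "x \<in> ell_infty \<Longrightarrow> (\<lambda>j. \<bar>x j\<bar>) \<in> ell_infty"
  by (simp add: ell_infty_def bounded_iff norm_abs_eq)

lemma norm_sup_inf_le:
  fixes a b :: "'e::banach_lattice"
  shows "norm (sup a b) \<le> norm a + norm b" "norm (inf a b) \<le> norm a + norm b"
proof -
  have *: "norm c \<le> norm a + norm b" if "\<bar>c\<bar> \<le> \<bar>a\<bar> + \<bar>b\<bar>" for c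
  proof -
    have "\<bar>c\<bar> \<le> \<bar>\<bar>a\<bar> + \<bar>b\<bar>\<bar>"
      using that by (simp add: order_trans[OF _ abs_ge_self])
    then have "norm c \<le> norm (\<bar>a\<bar> + \<bar>b\<bar>)"
      by (rule norm_mono_modulus)
    also have "\<dots> \<le> norm a + norm b"
      using norm_triangle_ineq[of "\<bar>a\<bar>" "\<bar>b\<bar>"] by (simp add: norm_abs_eq)
    finally show ?thesis .
  qed
  have le: "a \<le> \<bar>a\<bar> + \<bar>b\<bar>" "b \<le> \<bar>a\<bar> + \<bar>b\<bar>" "- a \<le> \<bar>a\<bar> + \<bar>b\<bar>" "- b \<le> \<bar>a\<bar> + \<bar>b\<bar>"
    by (meson abs_ge_self abs_ge_minus_self abs_ge_zero le_add_same_cancel1 le_add_same_cancel2 order_trans)+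
  show "norm (sup a b) \<le> norm a + norm b" "norm (inf a b) \<le> norm a + norm b"
    by (rule *, rule abs_leI;
        use le in \<open>auto simp: neg_sup_eq_inf neg_inf_eq_sup intro: le_infI1 le_infI2\<close>)+
qed

lemma sup_inf_ell_infty:
  fixes x y :: "nat \<Rightarrow> 'e::banach_lattice"
  assumes "x \<in> ell_infty" "y \<in> ell_infty"
  shows "sup x y \<in> ell_infty" "inf x y \<in> ell_infty"
proof -
  obtain a b where ab: "\<And>j. norm (x j) \<le> a" "\<And>j. norm (y j) \<le> b"
    using assms by (auto simp: ell_infty_def bounded_iff)
  have "norm (sup x y j) \<le> a + b" "norm (inf x y j) \<le> a + b" for j
    using norm_sup_inf_le[of "x j" "y j"] ab[of j] by simp_all
  then show "sup x y \<in> ell_infty" "inf x y \<in> ell_infty"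
    unfolding ell_infty_def bounded_iff by blast+
qed

lemma sup_in_eqI: "is_sup_in X x y z \<Longrightarrow> sup_in X x y = z"
  unfolding sup_in_def is_sup_in_def by (intro the_equality) (auto intro: antisym)

lemma inf_in_eqI: "is_inf_in X x y z \<Longrightarrow> inf_in X x y = z"
  unfolding inf_in_def is_inf_in_def by (intro the_equality) (auto intro: antisym)

lemma is_sup_in_ell_infty:
  "x \<in> ell_infty \<Longrightarrow> y \<in> ell_infty \<Longrightarrow> is_sup_in ell_infty x y (sup x y)"
  by (simp add: is_sup_in_def sup_inf_ell_infty)

lemma is_inf_in_ell_infty:
  "x \<in> ell_infty \<Longrightarrow> y \<in> ell_infty \<Longrightarrow> is_inf_in ell_infty x y (inf x y)"
  by (simp add: is_inf_in_def sup_inf_ell_infty)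

lemma norm_on_ell_infty: "norm_on (ell_infty :: (nat \<Rightarrow> 'e::banach_lattice) set) ell_infty_norm"
  unfolding norm_on_def
proof (intro conjI ballI allI)
  fix x :: "nat \<Rightarrow> 'e" assume x: "x \<in> ell_infty"
  show "0 \<le> ell_infty_norm x"
    using norm_le_ell_infty_norm[OF x, of 0] norm_ge_zero order_trans by blast
  show "ell_infty_norm x = 0 \<longleftrightarrow> x = 0"
    using norm_le_ell_infty_norm[OF x] by (auto simp: fun_eq_iff ell_infty_norm_def)
next
  fix c :: real and x :: "nat \<Rightarrow> 'e" assume x: "x \<in> ell_infty"
  show "ell_infty_norm (c *\<^sub>R x) = \<bar>c\<bar> * ell_infty_norm x"
  proof (rule antisym)
    show "ell_infty_norm (c *\<^sub>R x) \<le> \<bar>c\<bar> * ell_infty_norm x"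
      by (rule ell_infty_norm_le) (simp add: scaleR_fun_def mult_left_mono norm_le_ell_infty_norm[OF x])
    show "\<bar>c\<bar> * ell_infty_norm x \<le> ell_infty_norm (c *\<^sub>R x)"
    proof (cases "c = 0")
      case True
      then show ?thesis by (simp add: ell_infty_norm_def scaleR_fun_def)
    next
      case False
      have "c *\<^sub>R x \<in> ell_infty"
        by (rule subspace_scale[OF subspace_ell_infty x])
      then have "\<bar>c\<bar> * norm (x j) \<le> ell_infty_norm (c *\<^sub>R x)" for j
        using norm_le_ell_infty_norm[of "c *\<^sub>R x" j] by (simp add: scaleR_fun_def)
      then have "ell_infty_norm x \<le> ell_infty_norm (c *\<^sub>R x) / \<bar>c\<bar>"
        using False by (intro ell_infty_norm_le) (simp add: field_simps)
      then show ?thesis using False by (simp add: field_simps)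
    qed
  qed
next
  fix x y :: "nat \<Rightarrow> 'e" assume "x \<in> ell_infty" "y \<in> ell_infty"
  then show "ell_infty_norm (x + y) \<le> ell_infty_norm x + ell_infty_norm y"
    by (intro ell_infty_norm_le) (simp add: norm_triangle_mono norm_le_ell_infty_norm)
qed

lemma Metric_space_norm_dist_on:
  assumes "subspace X" "norm_on X N"
  shows "Metric_space X (norm_dist_on X N)"
proof
  have diff: "x - y \<in> X" if "x \<in> X" "y \<in> X" for x y
    using assms(1) that by (rule subspace_diff)
  have neg: "N (- x) = N x" if "x \<in> X" for x
    using assms(2) that unfolding norm_on_def by (metis abs_minus abs_one mult_1 scaleR_minus1_left)
  fix x y z
  show "0 \<le> norm_dist_on X N x y"
    using assms(2) diff by (auto simp: norm_dist_on_def norm_on_def)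
  show "norm_dist_on X N x y = norm_dist_on X N y x"
    using neg[of "x - y"] diff[of x y] by (auto simp: norm_dist_on_def)
  assume xy: "x \<in> X" "y \<in> X"
  then show "norm_dist_on X N x y = 0 \<longleftrightarrow> x = y"
    using assms(2) diff[OF xy] by (auto simp: norm_dist_on_def norm_on_def)
  assume z: "z \<in> X"
  have "N ((x - y) + (y - z)) \<le> N (x - y) + N (y - z)"
    using assms(2) diff[OF xy] diff[OF xy(2) z] by (simp only: norm_on_def)
  then show "norm_dist_on X N x z \<le> norm_dist_on X N x y + norm_dist_on X N y z"
    using xy z by (simp add: norm_dist_on_def)
qed

lemma mcomplete_ell_infty:
  "Metric_space.mcomplete (ell_infty :: (nat \<Rightarrow> 'e::banach_lattice) set)
     (norm_dist_on ell_infty ell_infty_norm)"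
proof -
  let ?X = "ell_infty :: (nat \<Rightarrow> 'e) set"
  let ?d = "norm_dist_on ?X ell_infty_norm"
  interpret Metric_space ?X ?d
    by (rule Metric_space_norm_dist_on[OF subspace_ell_infty norm_on_ell_infty])
  show ?thesis
    unfolding mcomplete_def
  proof (intro allI impI)
    fix \<sigma> :: "nat \<Rightarrow> nat \<Rightarrow> 'e" assume C: "MCauchy \<sigma>"
    then have in_X: "\<sigma> n \<in> ?X" for n
      by (auto simp: MCauchy_def)
    have diff_X: "f - g \<in> ?X" if "f \<in> ?X" "g \<in> ?X" for f g
      using subspace_ell_infty that by (rule subspace_diff)
    have pt: "norm (\<sigma> m j - \<sigma> n j) \<le> ?d (\<sigma> m) (\<sigma> n)" for m n j
      using norm_le_ell_infty_norm[OF diff_X[OF in_X in_X], of m n j]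
      by (simp add: norm_dist_on_def in_X)
    have CN: "\<exists>M. \<forall>m\<ge>M. \<forall>n\<ge>M. ?d (\<sigma> m) (\<sigma> n) < e" if "e > 0" for e
      using C that by (auto simp: MCauchy_def)
    have "Cauchy (\<lambda>n. \<sigma> n j)" for j
      unfolding Cauchy_iff using CN pt by (meson order_le_less_trans)
    then have "\<forall>j. \<exists>l. (\<lambda>n. \<sigma> n j) \<longlonglongrightarrow> l"
      by (auto simp: Cauchy_convergent_iff convergent_def)
    then obtain f where f: "\<And>j. (\<lambda>n. \<sigma> n j) \<longlonglongrightarrow> f j"
      by metis
    have close: "\<exists>M. \<forall>n\<ge>M. \<forall>j. norm (\<sigma> n j - f j) \<le> e" if "e > 0" for e
    proof -
      obtain M where M: "\<And>m n. m \<ge> M \<Longrightarrow> n \<ge> M \<Longrightarrow> ?d (\<sigma> m) (\<sigma> n) < e"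
        using CN[OF \<open>e > 0\<close>] by blast
      have "norm (\<sigma> n j - f j) \<le> e" if "n \<ge> M" for n j
      proof (rule tendsto_upperbound)
        show "(\<lambda>m. norm (\<sigma> n j - \<sigma> m j)) \<longlonglongrightarrow> norm (\<sigma> n j - f j)"
          by (intro tendsto_intros f)
        show "\<forall>\<^sub>F m in sequentially. norm (\<sigma> n j - \<sigma> m j) \<le> e"
          unfolding eventually_sequentially
          using M[OF that] pt by (meson less_imp_le order_trans)
      qed simp
      then show ?thesis by blast
    qed
    obtain M where M: "\<And>j. norm (\<sigma> M j - f j) \<le> 1"
      using close[of 1] by auto
    have "\<sigma> M - f \<in> ?X"
      unfolding ell_infty_def bounded_iff using M by auto
    then have "\<sigma> M - (\<sigma> M - f) \<in> ?X"
      by (rule diff_X[OF in_X])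
    then have fX: "f \<in> ?X"
      by simp
    have "\<exists>M. \<forall>n\<ge>M. \<sigma> n \<in> ?X \<and> ?d (\<sigma> n) f < e" if "e > 0" for e
    proof -
      obtain M where M: "\<And>n j. n \<ge> M \<Longrightarrow> norm (\<sigma> n j - f j) \<le> e / 2"
        using close[of "e / 2"] \<open>e > 0\<close> by auto
      have "?d (\<sigma> n) f < e" if "n \<ge> M" for n
      proof -
        have "ell_infty_norm (\<sigma> n - f) \<le> e / 2"
          using M[OF that] by (intro ell_infty_norm_le) simp
        then show ?thesis using in_X fX \<open>e > 0\<close> by (simp add: norm_dist_on_def)
      qed
      then show ?thesis using in_X by blast
    qed
    then show "\<exists>f. limitin mtopology \<sigma> f sequentially"
      using fX by (auto simp: limit_metric_sequentially)
  qed
qed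

lemma banach_sequence_lattice_ell_infty:
  "banach_sequence_lattice (ell_infty :: (nat \<Rightarrow> 'e::banach_lattice) set) ell_infty_norm"
  unfolding banach_sequence_lattice_def
proof (intro conjI ballI impI)
  fix x y :: "nat \<Rightarrow> 'e" assume xy: "x \<in> ell_infty" "y \<in> ell_infty"
  show "\<exists>z. is_sup_in ell_infty x y z" "\<exists>z. is_inf_in ell_infty x y z"
    using xy is_sup_in_ell_infty is_inf_in_ell_infty by blast+
  have "sup_in ell_infty f (- f) = sup f (- f)" if "f \<in> ell_infty" for f :: "nat \<Rightarrow> 'e"
    using that by (intro sup_in_eqI is_sup_in_ell_infty subspace_neg[OF subspace_ell_infty])
  moreover assume "sup_in ell_infty x (- x) \<le> sup_in ell_infty y (- y)"
  ultimately have "\<bar>x j\<bar> \<le> \<bar>y j\<bar>" for j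
    using xy by (simp add: le_fun_def abs_lattice)
  then have "norm (x j) \<le> ell_infty_norm y" for j
    by (rule order_trans[OF norm_mono_modulus norm_le_ell_infty_norm[OF xy(2)]])
  then show "ell_infty_norm x \<le> ell_infty_norm y"
    by (rule ell_infty_norm_le)
qed (simp_all add: subspace_ell_infty norm_on_ell_infty mcomplete_ell_infty)

end

theory Submission
  imports Defs
begin

text \<open>
  Both parts rest on the same construction. Let \<open>x\<close> be a positive sequence of the set in question,
  and pass to a subsequence \<open>y\<close> with \<open>norm (T (y j)) \<ge> \<epsilon> > 0\<close>. Split the
  indices into infinitely many infinite blocks and multiply \<open>y\<close> by bounded scalar sequences that
  are constant on each block. Order boundedness, disjointness and weak nullness survive bounded
  multipliers; a nonzero multiplier \<open>c\<close> has a value \<open>c k \<noteq> 0\<close> on some block, and on this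
  infinite block the images under \<open>T\<close> have norm at least \<open>\<bar>c k\<bar> * \<epsilon>\<close>. As
  \<open>y\<close> is positive the multiples form a sublattice, and as \<open>norm (y j)\<close> is bounded away
  from \<open>0\<close> it is a closed one, an isomorphic copy of the space of bounded scalar sequences. This is
  \<open>almost_positive_pointwise_latticeableI\<close>; it leaves the task of finding one positive member.

  For almost Dunford-Pettis operators, a disjoint weakly null sequence has a weakly null modulus
  (\<open>disjoint_weakly_null_abs\<close>, by the Hahn-Banach theorem), so the positive or the negative parts
  of a bad sequence form a bad positive sequence.

  For order weakly compact operators, disjoint order bounded sequences are weakly null, so what is
  needed is the theorem that \<open>T\<close> is order weakly compact if it maps positive disjoint order
  bounded sequences to null sequences (\<open>order_weakly_compactI\<close>). Suppose that
  \<open>T ` {0..x}\<close> is not relatively weakly compact. A gliding hump in the bidual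
  (\<open>not_relatively_weakly_compact_imp_separated\<close>) gives \<open>u n \<in> {0..x}\<close>, functionals
  \<open>\<phi> n\<close> of norm at most \<open>1\<close> and \<open>\<theta> > 0\<close> such that \<open>\<phi> p\<close> separates
  \<open>T v\<close> from \<open>T w\<close> by \<open>\<theta>\<close> whenever \<open>v\<close> is a convex combination of the
  \<open>u n\<close> with \<open>n < p\<close> and \<open>w\<close> one of those with \<open>n \<ge> p\<close>. On the other
  hand, the positive functional \<open>f\<close> that is a weighted sum of the moduli of the \<open>\<phi> n \<circ> T\<close>
  is a control measure for all of them at once (\<open>uniformly_absolutely_continuous\<close>), and near-minimisers
  of a convex function built from \<open>f\<close> are close for \<open>f\<close>. This yields \<open>v\<close> and
  \<open>w\<close> as above that all moduli fail to distinguish (\<open>close_convex_combinations\<close>), a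
  contradiction. The bridge between order and disjointness is an inequality that dominates
  \<open>(u - v)\<^sup>+\<close> by a small multiple of \<open>x\<close> and finitely many elements which become
  disjoint along a monotone sequence (\<open>pprt_diff_le_straddle_sum\<close>).
\<close>

section \<open>Extension of functionals\<close>

text \<open>The Hahn-Banach theorem for graphs: a partially defined functional is given by its graph, a subspace of
pairs, and the bound alone makes the graph single-valued. A maximal bounded subspace (Zorn) is the graph
of a total functional.\<close>

lemma bounded_extension:
  fixes G :: "('a::real_normed_vector \<times> real) set"
  assumes "subspace G" and bound: "\<And>v r. (v, r) \<in> G \<Longrightarrow> r \<le> C * norm v" and "0 \<le> C"
  obtains \<phi> where "bounded_linear \<phi>" "\<And>v r. (v, r) \<in> G \<Longrightarrow> \<phi> v = r"
    "\<And>v. \<bar>\<phi> v\<bar> \<le> C * norm v"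
proof -
  define \<A> where "\<A> = {M. subspace M \<and> G \<subseteq> M \<and> (\<forall>(v, r) \<in> M. r \<le> C * norm v)}"
  have "\<Union>\<C> \<in> \<A>" if ne: "\<C> \<noteq> {}" and chain: "subset.chain \<A> \<C>" for \<C>
  proof -
    have sub: "\<And>M. M \<in> \<C> \<Longrightarrow> subspace M"
      and tot: "\<And>M M'. M \<in> \<C> \<Longrightarrow> M' \<in> \<C> \<Longrightarrow> M \<subseteq> M' \<or> M' \<subseteq> M"
      using chain unfolding subset.chain_def \<A>_def by blast+
    have "subspace (\<Union>\<C>)"
      unfolding subspace_def
    proof (intro conjI ballI allI)
      show "0 \<in> \<Union>\<C>"
        using ne sub subspace_0 by blast
      show "c *\<^sub>R a \<in> \<Union>\<C>" if "a \<in> \<Union>\<C>" for c a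
        using that sub subspace_scale by blast
      fix a b assume "a \<in> \<Union>\<C>" "b \<in> \<Union>\<C>"
      then obtain M M' where "a \<in> M" "b \<in> M'" "M \<in> \<C>" "M' \<in> \<C>"
        by blast
      then show "a + b \<in> \<Union>\<C>"
        using tot[of M M'] sub subspace_add by blast
    qed
    then show ?thesis
      using chain ne unfolding \<A>_def subset.chain_def by blast
  qed
  moreover have "G \<in> \<A>"
    using assms by (auto simp: \<A>_def)
  ultimately obtain M where M: "M \<in> \<A>" and max: "\<And>M'. M' \<in> \<A> \<Longrightarrow> M \<subseteq> M' \<Longrightarrow> M' = M"
    using subset_Zorn_nonempty[of \<A>] by blast
  have subM: "subspace M" and GM: "G \<subseteq> M" and bM: "\<And>v r. (v, r) \<in> M \<Longrightarrow> r \<le> C * norm v"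
    using M by (auto simp: \<A>_def)
  have addM: "(v + v', r + r') \<in> M" if "(v, r) \<in> M" "(v', r') \<in> M" for v v' r r'
    using subspace_add[OF subM that] by simp
  have scaleM: "(c *\<^sub>R v, c * r) \<in> M" if "(v, r) \<in> M" for c v r
    using subspace_scale[OF subM that, of c] by simp
  have le: "r \<le> s" if "(v, r) \<in> M" "(v, s) \<in> M" for v r s
    using bM[OF addM[OF that(1) scaleM[OF that(2), of "-1"]]] by simp
  have total: "\<exists>r. (w, r) \<in> M" for w
  proof -
    \<comment> \<open>The value at \<open>w\<close> must lie between the elements of \<open>D\<close> and the bounds in \<open>key\<close>; the
      supremum of \<open>D\<close> does, and adjoining \<open>(w, c)\<close> to \<open>M\<close> keeps the bound.\<close>
    define D where "D = (\<lambda>(v, s). s - C * norm (v - w)) ` M"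
    have key: "d \<le> C * norm (v' + w) - s'" if "d \<in> D" "(v', s') \<in> M" for d v' s'
    proof -
      obtain v s where vs: "(v, s) \<in> M" "d = s - C * norm (v - w)"
        using \<open>d \<in> D\<close> by (auto simp: D_def)
      have "s + s' \<le> C * norm (v + v')"
        by (rule bM[OF addM[OF vs(1) that(2)]])
      also have "\<dots> \<le> C * (norm (v - w) + norm (v' + w))"
        using norm_triangle_ineq[of "v - w" "v' + w"] \<open>0 \<le> C\<close> by (intro mult_left_mono) simp_all
      finally show ?thesis
        using vs by (simp add: algebra_simps)
    qed
    have 0: "(0, 0) \<in> M"
      using subspace_0[OF subM] by (simp add: zero_prod_def)
    then have "D \<noteq> {}"
      by (auto simp: D_def)
    define c where "c = Sup D"
    have bdd: "bdd_above D"
      unfolding bdd_above_def using key[OF _ 0] by blast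
    have upper: "c \<le> C * norm (v + w) - s" if "(v, s) \<in> M" for v s
      unfolding c_def using key[OF _ that] \<open>D \<noteq> {}\<close> by (intro cSup_least) auto
    have lower: "s - C * norm (v - w) \<le> c" if "(v, s) \<in> M" for v s
      unfolding c_def using that by (intro cSup_upper[OF _ bdd]) (force simp: D_def)
    define M' where "M' = {a + b |a b. a \<in> M \<and> b \<in> span {(w, c)}}"
    have "M \<subseteq> M'"
    proof
      fix p assume "p \<in> M"
      moreover have "p = p + 0" "0 \<in> span {(w, c)}"
        by (simp_all add: span_zero)
      ultimately show "p \<in> M'"
        unfolding M'_def by blast
    qed
    have "M' \<in> \<A>"
    proof -
      have "r \<le> C * norm v" if vr: "(v, r) \<in> M'" for v r
      proof -
        obtain a s t where a: "(a, s) \<in> M" and v: "v = a + t *\<^sub>R w" "r = s + t * c"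
        proof -
          obtain p b where p: "p \<in> M" "b \<in> span {(w, c)}" "(v, r) = p + b"
            using vr unfolding M'_def by blast
          moreover obtain t where "b = t *\<^sub>R (w, c)"
            using p(2) unfolding span_singleton by blast
          ultimately show thesis
            using that[of "fst p" "snd p" t] by (simp add: prod_eq_iff)
        qed
        consider "t = 0" | "t > 0" | "t < 0"
          by linarith
        then show ?thesis
        proof cases
          case 1
          then show ?thesis using bM[OF a] v by simp
        next
          case 2
          have "c \<le> C * norm ((1 / t) *\<^sub>R a + w) - (1 / t) * s"
            by (rule upper[OF scaleM[OF a]])
          then have "t * c \<le> C * (t * norm ((1 / t) *\<^sub>R a + w)) - s"
            using 2 by (simp add: field_simps)
          also have "t * norm ((1 / t) *\<^sub>R a + w) = norm (t *\<^sub>R ((1 / t) *\<^sub>R a + w))"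
            using 2 by simp
          also have "t *\<^sub>R ((1 / t) *\<^sub>R a + w) = v"
            using 2 v by (simp add: scaleR_add_right)
          finally show ?thesis
            using v by simp
        next
          case 3
          have "(- 1 / t) * s - C * norm ((- 1 / t) *\<^sub>R a - w) \<le> c"
            by (rule lower[OF scaleM[OF a]])
          then have "(- t) * ((- 1 / t) * s - C * norm ((- 1 / t) *\<^sub>R a - w)) \<le> (- t) * c"
            using 3 by (intro mult_left_mono) auto
          then have "s + t * c \<le> C * ((- t) * norm ((- 1 / t) *\<^sub>R a - w))"
            using 3 by (simp add: algebra_simps)
          also have "(- t) * norm ((- 1 / t) *\<^sub>R a - w) = norm ((- t) *\<^sub>R ((- 1 / t) *\<^sub>R a - w))"
            using 3 by simp
          also have "(- t) *\<^sub>R ((- 1 / t) *\<^sub>R a - w) = v"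
            using 3 v by (simp add: scaleR_diff_right)
          finally show ?thesis
            using v by simp
        qed
      qed
      moreover note \<open>M \<subseteq> M'\<close>
      moreover have "subspace M'"
        unfolding M'_def by (intro subspace_sums subM subspace_span)
      ultimately show ?thesis
        using GM unfolding \<A>_def by blast
    qed
    moreover note \<open>M \<subseteq> M'\<close>
    ultimately have "M' = M"
      using max by blast
    moreover have "(w, c) \<in> M'"
    proof -
      have "(w, c) = 0 + (w, c)" "(w, c) \<in> span {(w, c)}"
        by (simp_all add: span_base)
      then show ?thesis
        unfolding M'_def using subspace_0[OF subM] by blast
    qed
    ultimately show ?thesis
      by blast
  qed
  define \<phi> where "\<phi> v = (SOME r. (v, r) \<in> M)" for v
  have \<phi>: "(v, \<phi> v) \<in> M" for v
    unfolding \<phi>_def using total by (rule someI_ex)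
  have eq: "\<phi> v = r" if "(v, r) \<in> M" for v r
    using le[OF \<phi> that] le[OF that \<phi>] by simp
  have abs: "\<bar>\<phi> v\<bar> \<le> C * norm v" for v
    using bM[OF \<phi>, of v] bM[OF scaleM[OF \<phi>, of "-1" v]] by simp
  show thesis
  proof
    show "bounded_linear \<phi>"
      by (rule bounded_linear_intro[where K = C])
        (auto intro!: eq addM scaleM \<phi> simp: abs mult.commute[of _ C])
    show "\<phi> v = r" if "(v, r) \<in> G" for v r
      using that GM eq by blast
  qed (rule abs)
qed

lemma norm_attained_by_functional:
  fixes v :: "'a::real_normed_vector"
  obtains \<phi> :: "'a \<Rightarrow>\<^sub>L real" where "norm \<phi> \<le> 1" "blinfun_apply \<phi> v = norm v"
proof -
  have "r \<le> 1 * norm w" if "(w, r) \<in> span {(v, norm v)}" for w r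
    using that mult_right_mono[OF abs_ge_self norm_ge_zero] by (auto simp: span_singleton)
  then obtain \<phi> where \<phi>: "bounded_linear \<phi>" "\<And>w r. (w, r) \<in> span {(v, norm v)} \<Longrightarrow> \<phi> w = r"
      "\<And>w. \<bar>\<phi> w\<bar> \<le> 1 * norm w"
    using bounded_extension[OF subspace_span, of "{(v, norm v)}" 1] by auto
  show thesis
  proof
    show "norm (Blinfun \<phi>) \<le> 1"
      using \<phi> by (intro norm_blinfun_bound) (auto simp: bounded_linear_Blinfun_apply)
    show "blinfun_apply (Blinfun \<phi>) v = norm v"
      using \<phi> span_base[of "(v, norm v)"] by (auto simp: bounded_linear_Blinfun_apply)
  qed
qed

lemma in_span_range_imp_sum:
  fixes x :: "nat \<Rightarrow> 'a::real_vector"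
  assumes "v \<in> span (range x)"
  obtains a n where "v = (\<Sum>j<n. a j *\<^sub>R x j)"
proof -
  obtain A d where A: "finite A" "A \<subseteq> range x" "v = (\<Sum>p\<in>A. d p *\<^sub>R p)"
    using assms unfolding span_explicit mem_Collect_eq by (elim exE conjE)
  then obtain I where I: "inj_on x I" "A = x ` I"
    using subset_image_inj[of A x UNIV] by auto
  have "finite I"
    using I A(1) finite_imageD by blast
  then have I_le: "I \<subseteq> {..<Suc (Max I)}"
    by (auto simp: less_Suc_eq_le)
  have "v = (\<Sum>j\<in>I. d (x j) *\<^sub>R x j)"
    using I A(3) by (simp add: sum.reindex)
  also have "\<dots> = (\<Sum>j<Suc (Max I). (if j \<in> I then d (x j) else 0) *\<^sub>R x j)"
    using I_le by (intro sum.mono_neutral_cong_left) auto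
  finally show thesis
    by (rule that)
qed

text \<open>Helly's form of the Hahn-Banach theorem: prescribed values on a sequence extend to a bounded functional
as soon as they are dominated on all finite linear combinations.\<close>

lemma functional_with_values:
  fixes x :: "nat \<Rightarrow> 'a::real_normed_vector"
  assumes bound: "\<And>a n. (\<Sum>j<n. a j * c j) \<le> C * norm (\<Sum>j<n. a j *\<^sub>R x j)" and "0 \<le> C"
  obtains \<phi> where "bounded_linear \<phi>" "\<And>j. \<phi> (x j) = c j"
proof -
  let ?G = "span (range (\<lambda>j. (x j, c j)))"
  have bound': "r \<le> C * norm v" if "(v, r) \<in> ?G" for v r
  proof -
    obtain a n where "(v, r) = (\<Sum>j<n. a j *\<^sub>R (x j, c j))"
      using \<open>(v, r) \<in> ?G\<close> by (rule in_span_range_imp_sum)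
    then have "v = fst (\<Sum>j<n. a j *\<^sub>R (x j, c j))" "r = snd (\<Sum>j<n. a j *\<^sub>R (x j, c j))"
      by (metis fst_conv, metis snd_conv)
    then show ?thesis
      using bound[of a n] by (simp add: fst_sum snd_sum)
  qed
  obtain \<phi> where \<phi>: "bounded_linear \<phi>" "\<And>v r. (v, r) \<in> ?G \<Longrightarrow> \<phi> v = r"
      "\<And>v. \<bar>\<phi> v\<bar> \<le> C * norm v"
    by (rule bounded_extension[of ?G C, OF subspace_span bound' \<open>0 \<le> C\<close>]; (rule that; assumption)?)
  show thesis
    by (rule that[OF \<phi>(1)], rule \<phi>(2), rule span_base, rule rangeI)
qed

section \<open>Weakly null sequences\<close>

lemma weakly_null_iff:
  "weakly_null x \<longleftrightarrow> (\<forall>\<phi>. bounded_linear \<phi> \<longrightarrow> (\<lambda>j. \<phi> (x j)) \<longlonglongrightarrow> (0::real))"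
proof (intro iffI allI impI)
  fix \<phi> :: "'a \<Rightarrow> real" assume x: "weakly_null x" and \<phi>: "bounded_linear \<phi>"
  show "(\<lambda>j. \<phi> (x j)) \<longlonglongrightarrow> 0"
  proof (rule topological_tendstoI)
    fix U :: "real set" assume "open U" "0 \<in> U"
    have "openin weak_topology (\<phi> -` U)"
      unfolding weak_topology_def using \<phi> \<open>open U\<close> by (intro topology_generated_by_Basis) blast
    moreover have "0 \<in> \<phi> -` U"
      using \<open>0 \<in> U\<close> \<phi> by (simp add: bounded_linear.linear linear_0)
    ultimately have "\<forall>\<^sub>F j in sequentially. x j \<in> \<phi> -` U"
      using x unfolding weakly_null_def limitin_def by blast
    then show "\<forall>\<^sub>F j in sequentially. \<phi> (x j) \<in> U"
      by simp
  qed
next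
  assume R: "\<forall>\<phi>. bounded_linear \<phi> \<longrightarrow> (\<lambda>j. \<phi> (x j)) \<longlonglongrightarrow> (0::real)"
  let ?S = "{\<phi> -` U | (\<phi> :: 'a \<Rightarrow> real) U. bounded_linear \<phi> \<and> open U}"
  have ev: "\<forall>\<^sub>F j in sequentially. x j \<in> U" if "generate_topology_on ?S U" "0 \<in> U" for U
    using that
  proof (induction rule: generate_topology_on.induct)
    case (Int a b)
    then show ?case by (auto intro: eventually_conj)
  next
    case (UN K)
    then obtain k where "k \<in> K" "0 \<in> k" by blast
    then have "\<forall>\<^sub>F j in sequentially. x j \<in> k"
      using UN by blast
    then show ?case
      using \<open>k \<in> K\<close> by (elim eventually_mono) blast
  next
    case (Basis s)
    then obtain \<phi> :: "'a \<Rightarrow> real" and U where s: "s = \<phi> -` U" "bounded_linear \<phi>" "open U"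
      by blast
    then have "0 \<in> U"
      using Basis by (simp add: bounded_linear.linear linear_0)
    then show ?case
      using s R topological_tendstoD[of "\<lambda>j. \<phi> (x j)" 0 sequentially U] by auto
  qed auto
  have "UNIV \<in> ?S"
    using bounded_linear_zero by (intro CollectI exI[of _ "\<lambda>_. 0"] exI[of _ UNIV]) auto
  then have "(0::'a) \<in> topspace weak_topology"
    unfolding weak_topology_def topology_generated_by_topspace by blast
  then show "weakly_null x"
    unfolding weakly_null_def limitin_def
    using ev by (simp add: weak_topology_def openin_topology_generated_by_iff)
qed

text \<open>Uniform boundedness on the dual space, which is complete: the functionals that are bounded by
\<open>n\<close> along the sequence form closed sets covering the dual, so one of them contains a ball, and
this bounds the sequence because norms are attained by functionals.\<close>

lemma weakly_null_bounded:
  fixes x :: "nat \<Rightarrow> 'a::real_normed_vector"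
  assumes "weakly_null x"
  shows "bounded (range x)"
proof -
  define A where "A n = {\<phi> :: 'a \<Rightarrow>\<^sub>L real. \<forall>j. \<bar>\<phi> (x j)\<bar> \<le> real n}" for n
  have "closed (A n)" for n
    unfolding A_def by (intro closed_Collect_all closed_Collect_le continuous_intros)
  moreover have "\<Union>(range A) = UNIV"
  proof (intro set_eqI iffI UNIV_I)
    fix \<phi> :: "'a \<Rightarrow>\<^sub>L real"
    have "(\<lambda>j. \<phi> (x j)) \<longlonglongrightarrow> 0"
      using assms blinfun.bounded_linear_right unfolding weakly_null_iff by blast
    then obtain K where "\<And>j. \<bar>\<phi> (x j)\<bar> \<le> K"
      by (metis Bseq_def convergentI convergent_imp_Bseq real_norm_def)
    moreover obtain n where "K \<le> real n"
      using real_arch_simple by blast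
    ultimately show "\<phi> \<in> \<Union>(range A)"
      unfolding A_def using order_trans by blast
  qed
  ultimately obtain n where "interior (A n) \<noteq> {}"
    using Baire_category_alt[of "euclidean :: ('a \<Rightarrow>\<^sub>L real) topology" "range A"]
      completely_metrizable_space_euclidean by auto
  then obtain \<phi>\<^sub>0 r where r: "r > 0" "cball \<phi>\<^sub>0 r \<subseteq> A n"
    by (metis all_not_in_conv mem_interior_cball)
  have "norm (x j) \<le> 2 * n / r" for j
  proof -
    obtain \<eta> :: "'a \<Rightarrow>\<^sub>L real" where \<eta>: "norm \<eta> \<le> 1" "\<eta> (x j) = norm (x j)"
      by (rule norm_attained_by_functional)
    have "\<phi>\<^sub>0 \<in> A n" "\<phi>\<^sub>0 + r *\<^sub>R \<eta> \<in> A n"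
      using r \<eta> by (auto intro!: subsetD[OF r(2)] simp: dist_norm mult_le_cancel_left1)
    then have "\<bar>\<phi>\<^sub>0 (x j)\<bar> \<le> n" "\<bar>\<phi>\<^sub>0 (x j) + r * norm (x j)\<bar> \<le> n"
      using \<eta>(2) by (auto simp: A_def blinfun.add_left blinfun.scaleR_left dest!: spec[of _ j])
    then show ?thesis
      using r(1) by (simp add: field_simps)
  qed
  then show ?thesis
    unfolding bounded_iff by blast
qed

section \<open>Weak compactness in the bidual\<close>

definition bidual_embedding :: "'a::real_normed_vector \<Rightarrow> ('a \<Rightarrow>\<^sub>L real) \<Rightarrow> real" where
  "bidual_embedding v = (\<lambda>\<phi>. blinfun_apply \<phi> v)"

text \<open>Weak compactness thus becomes compactness in a product of real lines, where Tychonoff's theorem applies.\<close>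

lemma weak_topology_eq_pullback: "weak_topology = pullback_topology UNIV bidual_embedding euclidean"
proof (rule topology_eq[THEN iffD2], intro allI iffI)
  fix U :: "'a set"
  let ?S = "{\<phi> -` U | (\<phi> :: 'a \<Rightarrow> real) U. bounded_linear \<phi> \<and> open U}"
  assume "openin weak_topology U"
  then have "generate_topology_on ?S U"
    by (simp add: weak_topology_def openin_topology_generated_by_iff)
  then have "\<exists>V. open V \<and> U = bidual_embedding -` V"
  proof (induction rule: generate_topology_on.induct)
    case (Int a b)
    then obtain V V' where "open V" "a = bidual_embedding -` V" "open V'" "b = bidual_embedding -` V'"
      by blast
    then show ?case
      by (intro exI[of _ "V \<inter> V'"]) auto
  next
    case (UN K)
    show ?case
    proof (intro exI conjI)
      show "open (\<Union>{V. open V \<and> bidual_embedding -` V \<in> K})"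
        by blast
      show "\<Union>K = bidual_embedding -` (\<Union>{V. open V \<and> bidual_embedding -` V \<in> K})"
      proof (intro set_eqI iffI)
        fix v assume "v \<in> \<Union>K"
        then obtain k where "k \<in> K" "v \<in> k"
          by blast
        moreover then obtain V where "open V" "k = bidual_embedding -` V"
          using UN by blast
        ultimately show "v \<in> bidual_embedding -` (\<Union>{V. open V \<and> bidual_embedding -` V \<in> K})"
          by auto
      qed auto
    qed
  next
    case (Basis s)
    then obtain \<phi> :: "'a \<Rightarrow> real" and V where s: "s = \<phi> -` V" "bounded_linear \<phi>" "open V"
      by blast
    have "open ((\<lambda>g. g (Blinfun \<phi>)) -` V)"
      using s(3) by (intro open_vimage continuous_on_product_coordinates)
    moreover have "s = bidual_embedding -` ((\<lambda>g. g (Blinfun \<phi>)) -` V)"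
      using s by (auto simp: bidual_embedding_def bounded_linear_Blinfun_apply)
    ultimately show ?case by blast
  qed auto
  then show "openin (pullback_topology UNIV bidual_embedding euclidean) U"
    by (auto simp: openin_pullback_topology)
next
  fix U :: "'a set"
  assume "openin (pullback_topology UNIV bidual_embedding euclidean) U"
  then obtain V where V: "open V" "U = bidual_embedding -` V"
    by (auto simp: openin_pullback_topology)
  have basis: "openin weak_topology (\<phi> -` A)" if "bounded_linear \<phi>" "open A" for \<phi> :: "'a \<Rightarrow> real" and A
    unfolding weak_topology_def using that by (intro topology_generated_by_Basis) blast
  have top: "topspace weak_topology = (UNIV :: 'a set)"
    using openin_subset[OF basis[OF bounded_linear_zero open_UNIV]] by auto
  have "continuous_map weak_topology euclidean (bidual_embedding :: 'a \<Rightarrow> _)"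
    unfolding euclidean_product_topology[symmetric] unfolding continuous_map_componentwise_UNIV
    unfolding continuous_map_def
    using basis[OF blinfun.bounded_linear_right]
    by (auto simp: top bidual_embedding_def vimage_def)
  then show "openin weak_topology U"
    using V openin_continuous_map_preimage[of weak_topology euclidean bidual_embedding V]
    by (simp add: top vimage_def)
qed

text \<open>The image of a bounded set lies in a product of compact intervals, so its pointwise closure is compact.
If this closure consists of evaluations at points, it is the homeomorphic image of a weakly compact set.\<close>

lemma relatively_weakly_compactI:
  fixes W :: "'a::real_normed_vector set"
  assumes "bounded W" and rep: "closure (bidual_embedding ` W) \<subseteq> range bidual_embedding"
  shows "relatively_weakly_compact W"
proof -
  let ?K = "closure (bidual_embedding ` W)"
  obtain R where R: "\<And>v. v \<in> W \<Longrightarrow> norm v \<le> R"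
    using \<open>bounded W\<close> by (auto simp: bounded_iff)
  have "compact ?K"
  proof -
    let ?P = "PiE UNIV (\<lambda>\<phi> :: 'a \<Rightarrow>\<^sub>L real. {- (R * norm \<phi>) .. R * norm \<phi>})"
    have "compact ?P"
      using compactin_PiE[of "\<lambda>_. euclidean :: real topology" UNIV
          "\<lambda>\<phi> :: 'a \<Rightarrow>\<^sub>L real. {- (R * norm \<phi>) .. R * norm \<phi>}"]
      by (simp add: euclidean_product_topology)
    moreover have "bidual_embedding ` W \<subseteq> ?P"
    proof -
      have "\<bar>blinfun_apply \<phi> v\<bar> \<le> R * norm \<phi>" if "v \<in> W" for \<phi> :: "'a \<Rightarrow>\<^sub>L real" and v
        using norm_blinfun[of \<phi> v] mult_right_mono[OF R[OF that] norm_ge_zero[of \<phi>]]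
        by (simp add: mult.commute)
      then show ?thesis
        by (auto simp: bidual_embedding_def abs_le_iff minus_le_iff)
    qed
    moreover have "closed ?P"
    proof -
      have "?P = (\<Inter>\<phi>. (\<lambda>g. g \<phi>) -` {- (R * norm \<phi>) .. R * norm \<phi>})"
        by (auto simp: PiE_def Pi_def)
      also have "closed \<dots>"
        by (intro closed_INT ballI closed_vimage continuous_on_product_coordinates closed_atLeastAtMost)
      finally show ?thesis .
    qed
    ultimately have "?P \<inter> ?K = ?K"
      by (intro Int_absorb1 closure_minimal)
    then show ?thesis
      using compact_Int_closed[OF \<open>compact ?P\<close> closed_closure, of "bidual_embedding ` W"] by (simp only:)
  qed
  have "compactin weak_topology (bidual_embedding -` ?K)"
    unfolding compactin_def
  proof (intro conjI allI impI)
    show "bidual_embedding -` ?K \<subseteq> topspace weak_topology"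
      by (simp add: weak_topology_eq_pullback topspace_pullback_topology)
    fix \<U> :: "'a set set"
    assume U: "Ball \<U> (openin weak_topology) \<and> bidual_embedding -` ?K \<subseteq> \<Union>\<U>"
    let ?V = "{V. open V \<and> bidual_embedding -` V \<in> \<U>}"
    have "?K \<subseteq> \<Union>?V"
    proof
      fix \<psi> assume "\<psi> \<in> ?K"
      moreover then obtain v where v: "\<psi> = bidual_embedding v"
        using rep by blast
      ultimately obtain A where "A \<in> \<U>" "v \<in> A"
        using U by blast
      moreover then obtain V where "open V" "A = bidual_embedding -` V"
        using U by (auto simp: weak_topology_eq_pullback openin_pullback_topology)
      ultimately show "\<psi> \<in> \<Union>?V"
        using v by auto
    qed
    then obtain \<F> where "\<F> \<subseteq> ?V" "finite \<F>" "?K \<subseteq> \<Union>\<F>"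
      using compactE[OF \<open>compact ?K\<close>, of ?V] by blast
    then show "\<exists>\<F>. finite \<F> \<and> \<F> \<subseteq> \<U> \<and> bidual_embedding -` ?K \<subseteq> \<Union>\<F>"
      by (intro exI[of _ "(\<lambda>V. bidual_embedding -` V) ` \<F>"]) (simp add: image_subset_iff subset_eq)
  qed
  moreover have "closedin weak_topology (bidual_embedding -` ?K)"
    unfolding weak_topology_eq_pullback closedin_def topspace_pullback_topology openin_pullback_topology
    by (auto intro!: exI[of _ "- ?K"])
  moreover have "W \<subseteq> bidual_embedding -` ?K"
    using closure_subset by fastforce
  ultimately show ?thesis
    unfolding relatively_weakly_compact_def
    by (metis closed_compactin closedin_closure_of closure_of_minimal)
qed

text \<open>Basic neighbourhoods in the topology of pointwise convergence constrain only finitely many coordinates.\<close>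

lemma closure_bidual_approx:
  assumes \<psi>: "\<psi> \<in> closure (bidual_embedding ` W)" and "finite P" "0 < e"
  obtains v where "v \<in> W" "\<And>\<phi>. \<phi> \<in> P \<Longrightarrow> \<bar>blinfun_apply \<phi> v - \<psi> \<phi>\<bar> < e"
proof -
  let ?O = "\<Inter>\<phi>\<in>P. (\<lambda>g. g \<phi>) -` ball (\<psi> \<phi>) e"
  have "open ?O"
    using \<open>finite P\<close> by (intro open_INT ballI open_vimage continuous_on_product_coordinates) auto
  moreover have "\<psi> \<in> ?O"
    using \<open>0 < e\<close> by auto
  ultimately obtain v where v: "v \<in> W" "bidual_embedding v \<in> ?O"
    using \<psi> unfolding closure_iff_nhds_not_empty by blast
  have "\<bar>blinfun_apply \<phi> v - \<psi> \<phi>\<bar> < e" if "\<phi> \<in> P" for \<phi>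
    using INT_D[OF v(2) that] by (simp add: bidual_embedding_def dist_real_def abs_minus_commute)
  with v(1) show thesis
    by (rule that)
qed

lemma closure_bidual_bounded_linear:
  fixes \<psi> :: "('a::real_normed_vector \<Rightarrow>\<^sub>L real) \<Rightarrow> real"
  assumes \<psi>: "\<psi> \<in> closure (bidual_embedding ` W)" and "bounded W"
  shows "bounded_linear \<psi>"
proof -
  obtain R where R: "\<And>v. v \<in> W \<Longrightarrow> norm v \<le> R"
    using \<open>bounded W\<close> by (auto simp: bounded_iff)
  show ?thesis
  proof (rule bounded_linear_intro[where K = R])
    fix \<phi> \<eta> :: "'a \<Rightarrow>\<^sub>L real" and c :: real
    have "\<bar>\<psi> (\<phi> + \<eta>) - (\<psi> \<phi> + \<psi> \<eta>)\<bar> \<le> e" if "e > 0" for e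
    proof -
      obtain v where "\<And>\<xi>. \<xi> \<in> {\<phi>, \<eta>, \<phi> + \<eta>} \<Longrightarrow> \<bar>blinfun_apply \<xi> v - \<psi> \<xi>\<bar> < e / 3"
        using closure_bidual_approx[OF \<psi>, of "{\<phi>, \<eta>, \<phi> + \<eta>}" "e / 3"] \<open>e > 0\<close> by auto
      then have "\<bar>blinfun_apply \<phi> v - \<psi> \<phi>\<bar> < e / 3" "\<bar>blinfun_apply \<eta> v - \<psi> \<eta>\<bar> < e / 3"
          "\<bar>blinfun_apply (\<phi> + \<eta>) v - \<psi> (\<phi> + \<eta>)\<bar> < e / 3"
        by blast+
      then have
          "\<bar>(blinfun_apply \<phi> v + blinfun_apply \<eta> v) - (\<psi> \<phi> + \<psi> \<eta>)\<bar> < 2 * (e / 3)"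
          "\<bar>(blinfun_apply \<phi> v + blinfun_apply \<eta> v) - \<psi> (\<phi> + \<eta>)\<bar> < e / 3"
        unfolding abs_less_iff blinfun.add_left by linarith+
      then show ?thesis
        unfolding abs_less_iff abs_le_iff by (intro conjI; linarith)
    qed
    then show "\<psi> (\<phi> + \<eta>) = \<psi> \<phi> + \<psi> \<eta>"
      using field_le_epsilon[of "\<bar>\<psi> (\<phi> + \<eta>) - (\<psi> \<phi> + \<psi> \<eta>)\<bar>" 0] by simp
    have "\<bar>\<psi> (c *\<^sub>R \<phi>) - c * \<psi> \<phi>\<bar> \<le> e" if "e > 0" for e
    proof -
      define d where "d = e / (1 + \<bar>c\<bar>)"
      have d: "d > 0" "d + \<bar>c\<bar> * d = e"
      proof -
        have "1 + \<bar>c\<bar> \<noteq> 0"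
          by linarith
        then have "(1 + \<bar>c\<bar>) * d = e"
          by (simp add: d_def)
        then show "d + \<bar>c\<bar> * d = e"
          by (simp add: distrib_right)
        show "d > 0"
          using \<open>e > 0\<close> by (simp add: d_def)
      qed
      obtain v where v: "\<And>\<xi>. \<xi> \<in> {\<phi>, c *\<^sub>R \<phi>} \<Longrightarrow> \<bar>blinfun_apply \<xi> v - \<psi> \<xi>\<bar> < d"
        using closure_bidual_approx[OF \<psi>, of "{\<phi>, c *\<^sub>R \<phi>}" d] d by auto
      have "\<bar>c * (blinfun_apply \<phi> v - \<psi> \<phi>)\<bar> \<le> \<bar>c\<bar> * d"
        using v[of \<phi>] by (simp add: abs_mult mult_left_mono)
      then show ?thesis
        using v[of "c *\<^sub>R \<phi>"] d(2) by (simp add: blinfun.scaleR_left algebra_simps)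
    qed
    then show "\<psi> (c *\<^sub>R \<phi>) = c *\<^sub>R \<psi> \<phi>"
      using field_le_epsilon[of "\<bar>\<psi> (c *\<^sub>R \<phi>) - c * \<psi> \<phi>\<bar>" 0] by simp
    have "norm (\<psi> \<phi>) \<le> norm \<phi> * R + e" if "e > 0" for e
    proof -
      obtain v where v: "v \<in> W" "\<bar>blinfun_apply \<phi> v - \<psi> \<phi>\<bar> < e"
        using closure_bidual_approx[OF \<psi>, of "{\<phi>}" e] \<open>e > 0\<close> by auto
      have "norm (blinfun_apply \<phi> v) \<le> norm \<phi> * R"
        using norm_blinfun[of \<phi> v] mult_left_mono[OF R[OF v(1)] norm_ge_zero[of \<phi>]] by linarith
      then show ?thesis
        using v(2) by simp
    qed
    then show "norm (\<psi> \<phi>) \<le> norm \<phi> * R"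
      by (rule field_le_epsilon)
  qed
qed

text \<open>A linear form that vanishes on the common kernel of finitely many evaluations is a combination of these
evaluations. The induction corrects \<open>\<rho>\<close> by a multiple of the evaluation at \<open>y\<close>.\<close>

lemma vanishing_on_annihilator_imp_evaluation:
  fixes \<rho> :: "('a::real_normed_vector \<Rightarrow>\<^sub>L real) \<Rightarrow> real"
  assumes "finite Y" "linear \<rho>"
    and "\<And>\<phi>. (\<And>y. y \<in> Y \<Longrightarrow> blinfun_apply \<phi> y = 0) \<Longrightarrow> \<rho> \<phi> = 0"
  shows "\<exists>v. \<forall>\<phi>. \<rho> \<phi> = blinfun_apply \<phi> v"
  using assms
proof (induction Y arbitrary: \<rho> rule: finite_induct)
  case empty
  then show ?case by (intro exI[of _ 0]) (simp add: blinfun.zero_right)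
next
  case (insert y Y)
  show ?case
  proof (cases "\<exists>\<phi>\<^sub>0 :: 'a \<Rightarrow>\<^sub>L real. (\<forall>z\<in>Y. blinfun_apply \<phi>\<^sub>0 z = 0) \<and> blinfun_apply \<phi>\<^sub>0 y \<noteq> 0")
    case True
    then obtain \<phi>\<^sub>0 :: "'a \<Rightarrow>\<^sub>L real" where \<phi>\<^sub>0: "\<And>z. z \<in> Y \<Longrightarrow> blinfun_apply \<phi>\<^sub>0 z = 0" "blinfun_apply \<phi>\<^sub>0 y \<noteq> 0"
      by metis
    define c where "c = \<rho> \<phi>\<^sub>0 / blinfun_apply \<phi>\<^sub>0 y"
    define \<rho>' where "\<rho>' \<phi> = \<rho> \<phi> - c * blinfun_apply \<phi> y" for \<phi>
    have "linear \<rho>'"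
      unfolding \<rho>'_def using insert.prems(1)
      by (auto intro!: linearI simp: linear_add linear_scale blinfun.add_left blinfun.scaleR_left algebra_simps)
    moreover have "\<rho>' \<phi> = 0" if "\<And>z. z \<in> Y \<Longrightarrow> blinfun_apply \<phi> z = 0" for \<phi>
    proof -
      define t where "t = blinfun_apply \<phi> y / blinfun_apply \<phi>\<^sub>0 y"
      have "\<rho> (\<phi> - t *\<^sub>R \<phi>\<^sub>0) = 0"
        using that \<phi>\<^sub>0
        by (intro insert.prems(2)) (auto simp: t_def blinfun.diff_left blinfun.scaleR_left)
      then have "\<rho> \<phi> = t * \<rho> \<phi>\<^sub>0"
        using insert.prems(1) by (simp add: linear_diff linear_scale)
      then show ?thesis
        by (simp add: \<rho>'_def c_def t_def)
    qed
    ultimately obtain v where "\<And>\<phi>. \<rho>' \<phi> = blinfun_apply \<phi> v"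
      using insert.IH by metis
    then have "\<rho> \<phi> = blinfun_apply \<phi> (v + c *\<^sub>R y)" for \<phi>
      by (simp add: \<rho>'_def blinfun.add_right blinfun.scaleR_right algebra_simps)
    then show ?thesis by blast
  next
    case False
    then show ?thesis
      using insert by (metis insert_iff)
  qed
qed

text \<open>Take \<open>\<psi>\<close> in the pointwise closure of \<open>W\<close> that is not an evaluation. As the space is
complete, \<open>\<psi>\<close> has a positive distance from all evaluations. Choose alternately \<open>\<phi> n\<close>
that vanishes at the earlier points while \<open>\<psi> (\<phi> n)\<close> stays large (possible by \<open>helly\<close>),
and \<open>y n\<close> in \<open>W\<close> that imitates \<open>\<psi>\<close> on the functionals chosen so far.\<close>

lemma not_relatively_weakly_compact_imp_separated:
  fixes W :: "'a::banach set"
  assumes "bounded W" "\<not> relatively_weakly_compact W"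
  obtains \<theta> y and \<phi> :: "nat \<Rightarrow> 'a \<Rightarrow>\<^sub>L real" where "0 < \<theta>" "\<And>n. y n \<in> W" "\<And>n. norm (\<phi> n) \<le> 1"
    "\<And>i n. i < n \<Longrightarrow> blinfun_apply (\<phi> n) (y i) = 0" "\<And>i n. n \<le> i \<Longrightarrow> \<theta> \<le> blinfun_apply (\<phi> n) (y i)"
proof -
  obtain \<psi> where \<psi>: "\<psi> \<in> closure (bidual_embedding ` W)" and not_eval: "\<psi> \<notin> range bidual_embedding"
    using assms relatively_weakly_compactI by blast
  have bl: "bounded_linear \<psi>"
    using \<psi> \<open>bounded W\<close> by (rule closure_bidual_bounded_linear)
  have lin: "linear \<psi>"
    using bl by (rule bounded_linear.linear)
  \<comment> \<open>If evaluations came arbitrarily close to \<open>\<psi>\<close>, their points would form a Cauchy sequence, and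
    \<open>\<psi>\<close> would be the evaluation at its limit.\<close>
  have "\<exists>d>0. \<forall>v. \<not> (\<forall>\<phi>. \<bar>\<psi> \<phi> - blinfun_apply \<phi> v\<bar> \<le> d * norm \<phi>)"
  proof (rule ccontr)
    assume "\<not> ?thesis"
    then have "\<exists>v. \<forall>\<phi>. \<bar>\<psi> \<phi> - blinfun_apply \<phi> v\<bar> \<le> inverse (real (Suc n)) * norm \<phi>" for n
      by (meson inverse_positive_iff_positive of_nat_0_less_iff zero_less_Suc)
    then obtain v where v: "\<And>n \<phi>. \<bar>\<psi> \<phi> - blinfun_apply \<phi> (v n)\<bar> \<le> inverse (real (Suc n)) * norm \<phi>"
      by metis
    have dist: "norm (v m - v n) \<le> inverse (real (Suc m)) + inverse (real (Suc n))" for m n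
    proof -
      obtain \<eta> :: "'a \<Rightarrow>\<^sub>L real" where \<eta>: "norm \<eta> \<le> 1" "blinfun_apply \<eta> (v m - v n) = norm (v m - v n)"
        by (rule norm_attained_by_functional)
      have "inverse (real (Suc k)) * norm \<eta> \<le> inverse (real (Suc k))" for k
        using \<eta>(1) by (simp add: mult_le_cancel_left1)
      then show ?thesis
        using v[of \<eta> m] v[of \<eta> n] \<eta>(2) by (smt (verit) blinfun.diff_right)
    qed
    have "Cauchy v"
    proof (rule CauchyI)
      fix e :: real assume "0 < e"
      then obtain N where N: "inverse (real (Suc N)) < e / 2"
        using reals_Archimedean[of "e / 2"] by auto
      have "norm (v m - v n) < e" if "m \<ge> N" "n \<ge> N" for m n
      proof -
        have "inverse (real (Suc k)) \<le> inverse (real (Suc N))" if "k \<ge> N" for k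
          using that by (simp add: field_simps)
        then show ?thesis
          using dist[of m n] N that by (smt (verit) field_sum_of_halves)
      qed
      then show "\<exists>M. \<forall>m\<ge>M. \<forall>n\<ge>M. norm (v m - v n) < e"
        by blast
    qed
    then obtain w where w: "v \<longlonglongrightarrow> w"
      by (auto simp: Cauchy_convergent_iff convergent_def)
    have "\<psi> \<phi> = blinfun_apply \<phi> w" for \<phi>
    proof -
      have "(\<lambda>n. blinfun_apply \<phi> (v n)) \<longlonglongrightarrow> \<psi> \<phi>"
      proof (rule LIM_zero_cancel, rule Lim_null_comparison)
        show "\<forall>\<^sub>F n in sequentially. norm (blinfun_apply \<phi> (v n) - \<psi> \<phi>) \<le> inverse (real (Suc n)) * norm \<phi>"
          using v by (simp add: abs_minus_commute)
        show "(\<lambda>n. inverse (real (Suc n)) * norm \<phi>) \<longlonglongrightarrow> 0"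
          using LIMSEQ_inverse_real_of_nat tendsto_mult_left_zero by blast
      qed
      moreover have "(\<lambda>n. blinfun_apply \<phi> (v n)) \<longlonglongrightarrow> blinfun_apply \<phi> w"
        by (intro tendsto_intros w)
      ultimately show ?thesis
        by (rule LIMSEQ_unique)
    qed
    then have "\<psi> = bidual_embedding w"
      by (auto simp: bidual_embedding_def)
    then show False
      using not_eval by blast
  qed
  then obtain d where "d > 0" and d: "\<And>v. \<not> (\<forall>\<phi>. \<bar>\<psi> \<phi> - blinfun_apply \<phi> v\<bar> \<le> d * norm \<phi>)"
    by blast
  \<comment> \<open>Otherwise \<open>\<psi>\<close> has norm at most \<open>d\<close> on the annihilator of \<open>Y\<close>. An extension of this
    restriction with the same bound differs from \<open>\<psi>\<close> by an evaluation, against the choice of \<open>d\<close>.\<close>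
  have helly: "\<exists>\<phi>. norm \<phi> \<le> 1 \<and> (\<forall>y\<in>Y. blinfun_apply \<phi> y = 0) \<and> d < \<psi> \<phi>" if "finite Y" for Y
  proof (rule ccontr)
    assume no: "\<not> ?thesis"
    define G where "G = {(\<phi>, \<psi> \<phi>) |\<phi>. \<forall>y\<in>Y. blinfun_apply \<phi> y = 0}"
    have "subspace G"
      unfolding subspace_def
    proof (intro conjI ballI allI)
      show "0 \<in> G"
        using linear_0[OF lin] by (auto simp: G_def zero_prod_def)
      show "a + b \<in> G" if "a \<in> G" "b \<in> G" for a b
        using that by (auto simp: G_def linear_add[OF lin] blinfun.add_left)
      show "c *\<^sub>R a \<in> G" if "a \<in> G" for c a
        using that by (auto simp: G_def linear_scale[OF lin] blinfun.scaleR_left)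
    qed
    moreover have "r \<le> d * norm \<phi>" if "(\<phi>, r) \<in> G" for \<phi> r
    proof (cases "\<phi> = 0")
      case True
      then show ?thesis
        using that linear_0[OF lin] by (simp add: G_def)
    next
      case False
      have "\<not> d < \<psi> ((1 / norm \<phi>) *\<^sub>R \<phi>)"
        using no that False
        by (auto simp: G_def blinfun.scaleR_left dest!: spec[of _ "(1 / norm \<phi>) *\<^sub>R \<phi>"])
      then show ?thesis
        using that False by (simp add: G_def linear_scale[OF lin] field_simps)
    qed
    ultimately obtain \<psi>' where \<psi>': "bounded_linear \<psi>'" "\<And>\<phi> r. (\<phi>, r) \<in> G \<Longrightarrow> \<psi>' \<phi> = r"
        "\<And>\<phi>. \<bar>\<psi>' \<phi>\<bar> \<le> d * norm \<phi>"
      using bounded_extension[of G d] \<open>d > 0\<close> by (metis less_imp_le)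
    have "\<exists>v. \<forall>\<phi>. \<psi> \<phi> - \<psi>' \<phi> = blinfun_apply \<phi> v"
      using \<psi>' \<open>finite Y\<close> lin
      by (intro vanishing_on_annihilator_imp_evaluation[of Y])
        (auto simp: G_def intro!: linear_compose_sub dest: bounded_linear.linear)
    then obtain v where "\<And>\<phi>. \<psi> \<phi> - \<psi>' \<phi> = blinfun_apply \<phi> v"
      by blast
    then have "\<psi> \<phi> - blinfun_apply \<phi> v = \<psi>' \<phi>" for \<phi>
      by (metis diff_diff_eq2 add_diff_cancel_left')
    then show False
      using d[of v] \<psi>'(3) by simp
  qed
  have approx: "\<exists>y\<in>W. \<forall>\<phi>\<in>P. d < blinfun_apply \<phi> y" if "finite P" "\<forall>\<phi>\<in>P. d < \<psi> \<phi>" for P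
  proof (cases "P = {}")
    case True
    then show ?thesis
      using closure_bidual_approx[OF \<psi>, of "{}" 1] by auto
  next
    case False
    define e where "e = Min (\<psi> ` P) - d"
    have "e > 0"
      using that False by (simp add: e_def)
    moreover have "d + e \<le> \<psi> \<phi>" if "\<phi> \<in> P" for \<phi>
      using that \<open>finite P\<close> by (simp add: e_def)
    ultimately show ?thesis
      using closure_bidual_approx[OF \<psi> \<open>finite P\<close>, of e] by (smt (verit, best))
  qed
  obtain F where F: "\<And>Y. finite Y \<Longrightarrow> norm (F Y) \<le> 1 \<and> (\<forall>y\<in>Y. blinfun_apply (F Y) y = 0) \<and> d < \<psi> (F Y)"
    using helly by metis
  obtain H where H: "\<And>P. finite P \<Longrightarrow> \<forall>\<phi>\<in>P. d < \<psi> \<phi> \<Longrightarrow> H P \<in> W \<and> (\<forall>\<phi>\<in>P. d < blinfun_apply \<phi> (H P))"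
    using approx by metis
  \<comment> \<open>The state of the recursion is the pair of the finite sets of points and functionals chosen so far.\<close>
  define step where "step = (\<lambda>(Y, P). (insert (H (insert (F Y) P)) Y, insert (F Y) P))"
  define S where "S n = (step ^^ n) ({}, {})" for n
  define \<phi> where "\<phi> n = F (fst (S n))" for n
  define y where "y n = H (snd (S (Suc n)))" for n
  have S_Suc: "S (Suc n) = (insert (y n) (fst (S n)), insert (\<phi> n) (snd (S n)))" for n
    by (simp add: S_def y_def \<phi>_def step_def case_prod_beta)
  have S_0: "S 0 = ({}, {})"
    by (simp add: S_def)
  have S: "S n = (y ` {..<n}, \<phi> ` {..<n})" for n
    by (induction n) (simp_all add: S_0 S_Suc lessThan_Suc)
  have \<phi>: "norm (\<phi> n) \<le> 1 \<and> (\<forall>y\<in>y ` {..<n}. blinfun_apply (\<phi> n) y = 0) \<and> d < \<psi> (\<phi> n)" for n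
    using F[of "fst (S n)"] by (simp only: \<phi>_def[symmetric]) (simp add: S)
  have "y n \<in> W \<and> (\<forall>\<phi>\<in>\<phi> ` {..<Suc n}. d < blinfun_apply \<phi> (y n))" for n
    using H[of "snd (S (Suc n))"] \<phi> unfolding y_def[symmetric] by (simp only: S snd_conv) auto
  then show thesis
    using that[of d y \<phi>] \<open>d > 0\<close> \<phi> by (auto simp: less_imp_le)
qed

section \<open>Lattice inequalities\<close>

lemma scaleR_inf:
  fixes a b :: "'e::banach_lattice"
  assumes "0 \<le> c"
  shows "c *\<^sub>R inf a b = inf (c *\<^sub>R a) (c *\<^sub>R b)"
proof (cases "c = 0")
  case False
  then have "c > 0"
    using assms by simp
  show ?thesis
  proof (rule antisym)
    show "c *\<^sub>R inf a b \<le> inf (c *\<^sub>R a) (c *\<^sub>R b)"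
      using assms by (auto intro: scaleR_left_mono)
    have "inverse c *\<^sub>R inf (c *\<^sub>R a) (c *\<^sub>R b) \<le> inverse c *\<^sub>R (c *\<^sub>R d)" if "d = a \<or> d = b" for d
      using that \<open>c > 0\<close> by (intro scaleR_left_mono) auto
    then have "inverse c *\<^sub>R inf (c *\<^sub>R a) (c *\<^sub>R b) \<le> inf a b"
      using \<open>c > 0\<close> by simp
    then have "c *\<^sub>R (inverse c *\<^sub>R inf (c *\<^sub>R a) (c *\<^sub>R b)) \<le> c *\<^sub>R inf a b"
      using assms by (rule scaleR_left_mono)
    then show "inf (c *\<^sub>R a) (c *\<^sub>R b) \<le> c *\<^sub>R inf a b"
      using \<open>c > 0\<close> by simp
  qed
qed simp

lemma scaleR_pprt:
  fixes a :: "'e::banach_lattice"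
  assumes "0 \<le> c"
  shows "c *\<^sub>R pprt a = pprt (c *\<^sub>R a)"
proof -
  have "c *\<^sub>R inf (- a) 0 = inf (- (c *\<^sub>R a)) 0"
    using scaleR_inf[OF assms, of "- a" 0] by simp
  then have "- (c *\<^sub>R inf (- a) 0) = - inf (- (c *\<^sub>R a)) 0"
    by simp
  then show ?thesis
    unfolding scaleR_minus_right[symmetric] by (simp add: pprt_def)
qed

lemma inf_add_le:
  fixes a b c :: "'e::lattice_ab_group_add"
  assumes "0 \<le> a" "0 \<le> b" "0 \<le> c"
  shows "inf (a + b) c \<le> inf a c + inf b c"
proof -
  have "inf a c + inf b c = inf (inf (a + b) (a + c)) (inf (c + b) (c + c))"
    by (simp add: add_sup_inf_distribs inf.assoc)
       (metis add.commute inf.assoc inf.left_commute)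
  moreover have "c \<le> a + c" "c \<le> c + b" "c \<le> c + c"
    using assms by simp_all
  ultimately show ?thesis
    by (auto intro: le_infI1 le_infI2)
qed

lemma inf_add_eq_0:
  fixes a b c :: "'e::lattice_ab_group_add"
  assumes "0 \<le> a" "0 \<le> b" "0 \<le> c" "inf a c = 0" "inf b c = 0"
  shows "inf (a + b) c = 0"
  using inf_add_le[of a b c] assms by (intro antisym) simp_all

lemma inf_scaleR_eq_0:
  fixes a b :: "'e::banach_lattice"
  assumes "0 \<le> a" "0 \<le> b" "inf a b = 0" "0 \<le> s" "0 \<le> t"
  shows "inf (s *\<^sub>R a) (t *\<^sub>R b) = 0"
proof (rule antisym)
  have "inf (s *\<^sub>R a) (t *\<^sub>R b) \<le> inf (max s t *\<^sub>R a) (max s t *\<^sub>R b)"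
    using assms by (intro inf_mono scaleR_right_mono) auto
  also have "\<dots> = max s t *\<^sub>R inf a b"
    using assms by (intro scaleR_inf[symmetric]) simp
  finally show "inf (s *\<^sub>R a) (t *\<^sub>R b) \<le> 0"
    by (simp only: \<open>inf a b = 0\<close> scaleR_zero_right)
qed (use assms in \<open>simp add: scaleR_nonneg_nonneg\<close>)

lemma inf_mono_eq_0:
  fixes a b c d :: "'e::lattice_ab_group_add"
  assumes "inf a b = 0" "0 \<le> c" "c \<le> a" "0 \<le> d" "d \<le> b"
  shows "inf c d = 0"
  using inf_mono[OF assms(3,5)] assms by (intro antisym) simp_all

lemma inf_pprt_pprt_uminus: "inf (pprt a) (pprt (- a)) = (0 :: 'e::lattice_ab_group_add)"
proof -
  have "inf (pprt a) (pprt (- a)) = pprt (- a) + inf (pprt a - pprt (- a)) 0"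
    by (simp add: add_inf_distrib_left)
  also have "pprt a - pprt (- a) = a"
    using prts[of a] by (simp add: pprt_neg)
  finally show ?thesis
    unfolding pprt_neg nprt_def[symmetric] by simp
qed

lemma le_pprt: "a \<le> pprt (a :: 'e::lattice_ab_group_add)"
  by (simp add: pprt_def)

lemma pprt_le: "a \<le> b \<Longrightarrow> 0 \<le> b \<Longrightarrow> pprt a \<le> (b :: 'e::lattice_ab_group_add)"
  by (simp add: pprt_def)

lemma pprt_diff_le: "0 \<le> b \<Longrightarrow> 0 \<le> a \<Longrightarrow> pprt (a - b) \<le> (a :: 'e::lattice_ab_group_add)"
  by (rule pprt_le) simp_all

text \<open>For functions, \<open>straddle v u a\<close> is positive exactly where the level \<open>a\<close> lies strictly
  between \<open>v\<close> and \<open>u\<close>.\<close>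

definition straddle :: "'e::lattice_ab_group_add \<Rightarrow> 'e \<Rightarrow> 'e \<Rightarrow> 'e" where
  "straddle v u a = inf (pprt (u - a)) (pprt (a - v))"

lemma straddle_nonneg: "0 \<le> straddle v u a"
  by (simp add: straddle_def)

lemma straddle_le: "0 \<le> a \<Longrightarrow> 0 \<le> u \<Longrightarrow> straddle v u a \<le> u"
  unfolding straddle_def using pprt_diff_le by (blast intro: le_infI1)

text \<open>Pointwise, if \<open>u\<close> exceeds \<open>v\<close> by more than the mesh \<open>s\<close>, then multiples of \<open>s\<close> lie between
them, and the levels between \<open>v\<close> and \<open>u\<close> add up to at least \<open>u - v - s\<close>. In a vector lattice one truncates
\<open>u\<close> at successive levels: raising the truncation from \<open>k s\<close> to \<open>(k + 1) s\<close> increases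
\<open>(u - v - s)\<^sup>+\<close> by at most the contribution of the level \<open>k s\<close>.\<close>

lemma pprt_diff_le_straddle_sum:
  fixes u v s :: "'e::banach_lattice"
  assumes "0 \<le> s" "0 \<le> v" "u \<le> real N *\<^sub>R s"
  shows "pprt (u - v) \<le> s + (\<Sum>i<N. straddle v u (real i *\<^sub>R s))"
proof -
  \<comment> \<open>Starts at \<open>0\<close> since \<open>inf u 0 \<le> v + s\<close>, and \<open>M N\<close> is \<open>(u - v - s)\<^sup>+\<close>.\<close>
  define M where "M k = pprt (inf u (real k *\<^sub>R s) - v - s)" for k
  have "M (Suc k) \<le> M k + straddle v u (real k *\<^sub>R s)" for k
  proof -
    let ?a = "u - real k *\<^sub>R s" and ?b = "real k *\<^sub>R s - v"
    let ?c = "inf u (real k *\<^sub>R s) - v - s"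
    let ?d = "inf u (real (Suc k) *\<^sub>R s) - v - s"
    have "inf u (real (Suc k) *\<^sub>R s) \<le> real k *\<^sub>R s + s"
      by (simp add: algebra_simps)
    then have "?d \<le> ?b"
      by (simp add: algebra_simps)
    also have "\<dots> \<le> pprt ?c + pprt ?b"
      by (meson add_increasing le_pprt zero_le_pprt)
    finally have 1: "?d \<le> pprt ?c + pprt ?b" .
    have "inf u (real (Suc k) *\<^sub>R s) \<le> inf u (real k *\<^sub>R s) + pprt ?a"
    proof -
      have "u \<le> real k *\<^sub>R s + pprt ?a"
        using le_pprt[of ?a] by (simp add: algebra_simps)
      then have "u \<le> inf u (real k *\<^sub>R s) + pprt ?a"
        by (simp add: add_inf_distrib_right)
      then show ?thesis
        by (rule le_infI1)
    qed
    then have "?d \<le> ?c + pprt ?a"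
      by (simp add: algebra_simps)
    also have "\<dots> \<le> pprt ?c + pprt ?a"
      by (intro add_right_mono le_pprt)
    finally have "?d \<le> inf (pprt ?c + pprt ?a) (pprt ?c + pprt ?b)"
      using 1 by simp
    also have "\<dots> = pprt ?c + straddle v u (real k *\<^sub>R s)"
      by (simp add: straddle_def add_inf_distrib_left)
    finally show ?thesis
      unfolding M_def by (rule pprt_le) (simp add: straddle_nonneg)
  qed
  moreover have "M 0 = 0"
  proof -
    have "inf u 0 \<le> v + s"
      using assms by (intro le_infI2) simp
    then show ?thesis
      unfolding M_def by (intro pprt_eq_0) (simp add: algebra_simps)
  qed
  ultimately have "M k \<le> (\<Sum>i<k. straddle v u (real i *\<^sub>R s))" for k
  proof (induction k)
    case (Suc k)
    have "M (Suc k) \<le> M k + straddle v u (real k *\<^sub>R s)"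
      by (rule Suc.prems)
    also have "\<dots> \<le> (\<Sum>i<Suc k. straddle v u (real i *\<^sub>R s))"
      using Suc by simp
    finally show ?case .
  qed simp
  moreover have "pprt (u - v) \<le> s + M N"
  proof (rule pprt_le)
    have "M N = pprt (u - v - s)"
      using assms(3) by (simp add: M_def inf_absorb1)
    then show "u - v \<le> s + M N"
      using le_pprt[of "u - v - s"] by (simp add: algebra_simps)
    show "0 \<le> s + M N"
      using assms(1) by (simp add: M_def)
  qed
  ultimately show ?thesis
    by (meson add_left_mono order_trans)
qed

text \<open>An increasing sequence passes a given level only once: where it has passed the level \<open>a\<close> between
\<open>v\<close> and \<open>u\<close>, it is above \<open>a\<close> from then on.\<close>

lemma straddle_disjoint:
  assumes "u \<le> v'"
  shows "inf (straddle v u a) (straddle v' u' a) = 0"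
proof (rule inf_mono_eq_0[OF inf_pprt_pprt_uminus[of "v' - a"]])
  have "pprt (u - a) \<le> pprt (v' - a)"
    using assms by simp
  then show "straddle v u a \<le> pprt (v' - a)"
    unfolding straddle_def by (rule le_infI1)
  show "straddle v' u' a \<le> pprt (- (v' - a))"
    unfolding straddle_def by simp
qed (rule straddle_nonneg)+

text \<open>The positive part is subadditive, with a defect where \<open>b\<close> is positive and \<open>c\<close> negative.\<close>

lemma inf_pprt_add_pprt_le:
  fixes b c :: "'e::lattice_ab_group_add"
  shows "inf (pprt b) (pprt (- c)) + pprt (b + c) \<le> pprt b + pprt c"
proof -
  have "pprt (b + c) \<le> pprt b + pprt c - inf (pprt b) (pprt (- c))"
  proof (rule pprt_le)
    have "inf (pprt b) (pprt (- c)) \<le> pprt (- b) + pprt (- c)"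
      by (intro le_infI2 add_increasing zero_le_pprt order_refl)
    also have "\<dots> = pprt b + pprt c - (b + c)"
    proof -
      have eq: "pprt (- a) = pprt a - a" for a :: 'e
      proof -
        have "pprt a - a = pprt a - (pprt a + nprt a)"
          by (subst prts[of a]) (rule refl)
        then show ?thesis
          by (simp add: pprt_neg)
      qed
      show ?thesis
        unfolding eq[of b] eq[of c] by (simp add: algebra_simps)
    qed
    finally show "b + c \<le> pprt b + pprt c - inf (pprt b) (pprt (- c))"
      unfolding le_diff_eq by (simp add: add.commute)
    have "inf (pprt b) (pprt (- c)) \<le> pprt b"
      by simp
    also have "\<dots> \<le> pprt b + pprt c"
      by simp
    finally show "0 \<le> pprt b + pprt c - inf (pprt b) (pprt (- c))"
      by (simp only: diff_ge_0_iff_ge)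
  qed
  then show ?thesis
    unfolding le_diff_eq by (simp only: add.commute)
qed

text \<open>The defect of convexity of \<open>\<lambda>y. (y - a)\<^sup>+\<close> at the midpoint of \<open>u\<close> and
\<open>v\<close> controls how far the level \<open>a\<close> separates the two points.\<close>

lemma straddle_add_pprt_le:
  fixes u v a :: "'e::banach_lattice"
  shows "straddle v u a + 2 *\<^sub>R pprt ((1 / 2) *\<^sub>R u + (1 / 2) *\<^sub>R v - a) \<le> pprt (u - a) + pprt (v - a)"
proof -
  have "2 *\<^sub>R ((1 / 2) *\<^sub>R u + (1 / 2) *\<^sub>R v - a) = (u - a) + (v - a)"
    by (simp add: scaleR_add_right scaleR_diff_right) (simp add: scaleR_2)
  then have "2 *\<^sub>R pprt ((1 / 2) *\<^sub>R u + (1 / 2) *\<^sub>R v - a) = pprt ((u - a) + (v - a))"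
    using scaleR_pprt[of 2 "(1 / 2) *\<^sub>R u + (1 / 2) *\<^sub>R v - a"] by simp
  then show ?thesis
    using inf_pprt_add_pprt_le[of "u - a" "v - a"] by (simp add: straddle_def)
qed

section \<open>Seminorms that vanish along disjoint sequences\<close>

text \<open>A monotone seminorm on the positive cone for which disjoint sequences in the order interval
\<open>{0..x}\<close> are null. It plays the role of an order continuous lattice norm on the ideal generated by
\<open>x\<close>.\<close>

locale disjointly_null_seminorm =
  fixes q :: "'e::banach_lattice \<Rightarrow> real" and x :: 'e
  assumes mono: "0 \<le> y \<Longrightarrow> y \<le> z \<Longrightarrow> q y \<le> q z"
    and subadd: "0 \<le> y \<Longrightarrow> 0 \<le> z \<Longrightarrow> q (y + z) \<le> q y + q z"
    and scale: "0 \<le> c \<Longrightarrow> 0 \<le> y \<Longrightarrow> q (c *\<^sub>R y) = c * q y"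
    and disjointly_null: "(\<And>n. 0 \<le> w n) \<Longrightarrow> (\<And>n. w n \<le> x) \<Longrightarrow> disjoint_seq w \<Longrightarrow> (\<lambda>n. q (w n)) \<longlonglongrightarrow> 0"
    and unit_nonneg: "0 \<le> x"
begin

lemma zero [simp]: "q 0 = 0"
  using scale[of 0 0] by simp

lemma nonneg: "0 \<le> y \<Longrightarrow> 0 \<le> q y"
  using mono[of 0 y] by simp

lemma sum_le:
  assumes "finite I" "\<And>i. i \<in> I \<Longrightarrow> 0 \<le> y i"
  shows "q (\<Sum>i\<in>I. y i) \<le> (\<Sum>i\<in>I. q (y i))"
  using assms
proof (induction I rule: finite_induct)
  case (insert i I)
  have "q (y i + sum y I) \<le> q (y i) + q (sum y I)"
    using insert by (intro subadd sum_nonneg) auto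
  then show ?case
    using insert by simp
qed simp

lemma fine_mesh:
  assumes "0 < \<epsilon>"
  obtains N :: nat where "0 < N" "q x / real N < \<epsilon>"
proof -
  obtain N :: nat where N: "q x / \<epsilon> < real N"
    using reals_Archimedean2 by blast
  have "0 \<le> q x / \<epsilon>"
    using nonneg[OF unit_nonneg] \<open>0 < \<epsilon>\<close> by simp
  with N have "0 < N"
    by linarith
  moreover from this N have "q x / real N < \<epsilon>"
    using \<open>0 < \<epsilon>\<close> by (simp add: field_simps)
  ultimately show thesis by (rule that)
qed

lemma diff_le_straddle_sum:
  assumes "0 \<le> v" "u \<le> x" "0 < N" "0 \<le> u"
  shows "q (pprt (u - v)) \<le> q x / real N + (\<Sum>i<N. q (straddle v u ((real i / real N) *\<^sub>R x)))"
proof -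
  let ?s = "(1 / real N) *\<^sub>R x"
  have "pprt (u - v) \<le> ?s + (\<Sum>i<N. straddle v u (real i *\<^sub>R ?s))"
    using assms unit_nonneg by (intro pprt_diff_le_straddle_sum) (auto simp: scaleR_nonneg_nonneg)
  then have "q (pprt (u - v)) \<le> q (?s + (\<Sum>i<N. straddle v u (real i *\<^sub>R ?s)))"
    by (intro mono) auto
  also have "\<dots> \<le> q ?s + q (\<Sum>i<N. straddle v u (real i *\<^sub>R ?s))"
    using unit_nonneg by (intro subadd sum_nonneg straddle_nonneg scaleR_nonneg_nonneg) auto
  also have "\<dots> \<le> q ?s + (\<Sum>i<N. q (straddle v u (real i *\<^sub>R ?s)))"
    by (intro add_left_mono sum_le straddle_nonneg) auto
  also have "\<dots> = q x / real N + (\<Sum>i<N. q (straddle v u ((real i / real N) *\<^sub>R x)))"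
    using unit_nonneg by (simp add: scale)
  finally show ?thesis .
qed

text \<open>Cut the increments of \<open>v\<close> into \<open>N\<close> levels. Along increments over successive intervals of
indices the contributions of one level are disjoint, hence null for \<open>q\<close>, and the remainder
\<open>q x / N\<close> is small for large \<open>N\<close>.\<close>

lemma increasing_Cauchy:
  assumes inc: "incseq v" and bounds: "\<And>n. 0 \<le> v n" "\<And>n. v n \<le> x" and "0 < \<epsilon>"
  shows "\<exists>M. \<forall>n\<ge>M. \<forall>m\<ge>n. q (v m - v n) \<le> \<epsilon>"
proof (rule ccontr)
  assume "\<not> ?thesis"
  then have "\<forall>M. \<exists>n m. n \<ge> M \<and> m \<ge> n \<and> q (v m - v n) > \<epsilon>"
    by (meson not_le_imp_less)
  then obtain f g where fg: "\<And>M. f M \<ge> M" "\<And>M. g M \<ge> f M" "\<And>M. q (v (g M) - v (f M)) > \<epsilon>"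
    by metis
  \<comment> \<open>Large increments between \<open>f (K k)\<close> and \<open>g (K k)\<close>, over intervals of indices that do not overlap.\<close>
  define K where "K k = (g ^^ k) 0" for k
  have K_Suc: "K (Suc k) = g (K k)" for k
    by (simp add: K_def)
  have "incseq K"
    unfolding incseq_Suc_iff K_Suc using fg(1,2) order_trans by blast
  define a where "a k = v (f (K k))" for k
  define b where "b k = v (g (K k))" for k
  have ab: "0 \<le> a k" "a k \<le> x" "0 \<le> b k" "b k \<le> x" "a k \<le> b k" for k
    using bounds incseqD[OF inc fg(2)] by (auto simp: a_def b_def)
  have b_le_a: "b k \<le> a l" if "k < l" for k l
  proof -
    have "g (K k) \<le> K l"
      using incseqD[OF \<open>incseq K\<close>, of "Suc k" l] that by (simp add: K_Suc)
    then show ?thesis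
      unfolding a_def b_def using fg(1) by (intro incseqD[OF inc]) (meson order_trans)
  qed
  have null: "(\<lambda>k. q (straddle (a k) (b k) c)) \<longlonglongrightarrow> 0" if "0 \<le> c" for c
  proof (rule disjointly_null)
    show "straddle (a k) (b k) c \<le> x" for k
      using straddle_le[OF that ab(3)] ab(4) by (rule order_trans)
    show "disjoint_seq (\<lambda>k. straddle (a k) (b k) c)"
      unfolding disjoint_seq_def
    proof (intro allI impI)
      fix k l :: nat assume "k \<noteq> l"
      then show "inf \<bar>straddle (a k) (b k) c\<bar> \<bar>straddle (a l) (b l) c\<bar> = 0"
      proof (induction k l rule: linorder_wlog)
        case (le k l)
        then show ?case
          using straddle_disjoint[OF b_le_a[of k l]] by (simp add: abs_of_nonneg straddle_nonneg)
      qed (simp add: inf.commute)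
    qed
  qed (rule straddle_nonneg)
  obtain N where N: "0 < N" "q x / real N < \<epsilon> / 2"
    using half_gt_zero[OF \<open>0 < \<epsilon>\<close>] by (rule fine_mesh)
  have "(\<lambda>k. \<Sum>i<N. q (straddle (a k) (b k) ((real i / real N) *\<^sub>R x))) \<longlonglongrightarrow> (\<Sum>i<N. 0)"
    using unit_nonneg by (intro tendsto_sum null scaleR_nonneg_nonneg) auto
  then have "\<forall>\<^sub>F k in sequentially. (\<Sum>i<N. q (straddle (a k) (b k) ((real i / real N) *\<^sub>R x))) < \<epsilon> / 2"
    using \<open>0 < \<epsilon>\<close> by (intro order_tendstoD) auto
  then obtain k where "(\<Sum>i<N. q (straddle (a k) (b k) ((real i / real N) *\<^sub>R x))) < \<epsilon> / 2"
    by (auto simp: eventually_sequentially)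
  moreover have "q (b k - a k) \<le> q x / real N + (\<Sum>i<N. q (straddle (a k) (b k) ((real i / real N) *\<^sub>R x)))"
    using diff_le_straddle_sum[of "a k" "b k" N] ab[of k] N(1) by simp
  moreover have "\<epsilon> < q (b k - a k)"
    unfolding a_def b_def by (rule fg(3))
  ultimately show False
    using N(2) by linarith
qed

lemma decreasing_Cauchy:
  assumes dec: "decseq v" and bounds: "\<And>n. 0 \<le> v n" "\<And>n. v n \<le> x" and "0 < \<epsilon>"
  shows "\<exists>M. \<forall>n\<ge>M. \<forall>m\<ge>n. q (v n - v m) \<le> \<epsilon>"
  using increasing_Cauchy[of "\<lambda>n. x - v n" \<epsilon>] assms by (simp add: incseq_def decseq_def)

text \<open>Countably many functionals dominated by \<open>q\<close> and each absolutely continuous with respect to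
\<open>f\<close> are so uniformly. The proof is in the manner of Egorov: if \<open>h (m n)\<close> is large at \<open>y n\<close> although \<open>f (y n)\<close>
decays fast, then up to \<open>q\<close>-small errors the \<open>y k\<close> are dominated by a decreasing sequence
\<open>p\<close> with \<open>f (p k) \<longlonglongrightarrow> 0\<close>. Since \<open>p\<close> is Cauchy for \<open>q\<close>, one fixed functional
\<open>h (m K)\<close> stays large along \<open>p\<close>, which contradicts its absolute continuity.\<close>

lemma uniformly_absolutely_continuous:
  fixes h :: "nat \<Rightarrow> 'e \<Rightarrow> real"
  assumes h_mono: "\<And>m y z. 0 \<le> y \<Longrightarrow> y \<le> z \<Longrightarrow> h m y \<le> h m z"
    and h_subadd: "\<And>m y z. 0 \<le> y \<Longrightarrow> 0 \<le> z \<Longrightarrow> h m (y + z) \<le> h m y + h m z"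
    and h_le_q: "\<And>m y. 0 \<le> y \<Longrightarrow> h m y \<le> q y"
    and h_le_f: "\<And>m y. 0 \<le> y \<Longrightarrow> h m y \<le> C m * f y"
    and f_mono: "\<And>y z. 0 \<le> y \<Longrightarrow> y \<le> z \<Longrightarrow> f y \<le> f z"
    and f_subadd: "\<And>y z. 0 \<le> y \<Longrightarrow> 0 \<le> z \<Longrightarrow> f (y + z) \<le> f y + f z"
    and "0 < \<epsilon>"
  shows "\<exists>\<delta>>0. \<forall>y. 0 \<le> y \<and> y \<le> x \<and> f y < \<delta> \<longrightarrow> (\<forall>m. h m y \<le> \<epsilon>)"
proof (rule ccontr)
  assume "\<not> ?thesis"
  then have "\<forall>n. \<exists>y m. 0 \<le> y \<and> y \<le> x \<and> f y < (1 / 2) ^ n \<and> \<epsilon> < h m y"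
    by (meson not_le_imp_less zero_less_divide_1_iff zero_less_numeral zero_less_power)
  then obtain y m where y: "\<And>n. 0 \<le> y n" "\<And>n. y n \<le> x" "\<And>n. f (y n) < (1 / 2) ^ n"
      and h_large: "\<And>n. \<epsilon> < h (m n) (y n)"
    by metis
  \<comment> \<open>\<open>W k d\<close> is the supremum of \<open>y k, \<dots>, y (k + d)\<close>.\<close>
  define W where "W k = rec_nat (y k) (\<lambda>d w. sup w (y (k + Suc d)))" for k
  have W_0: "W k 0 = y k" and W_Suc: "W k (Suc d) = sup (W k d) (y (k + Suc d))" for k d
    by (simp_all add: W_def)
  have W_inc: "incseq (W k)" for k
    by (simp add: incseq_Suc_iff W_Suc)
  have W_bounds: "0 \<le> W k d" "W k d \<le> x" for k d
    by (induction d) (auto simp: W_0 W_Suc y intro: le_supI1)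
  have y_le_W: "y j \<le> W k d" if "k \<le> j" "j \<le> k + d" for j k d
    using that
  proof (induction d)
    case (Suc d)
    then show ?case
      by (cases "j = k + Suc d") (auto simp: W_Suc intro: le_supI1)
  qed (simp add: W_0)
  have f_W: "f (W k d) \<le> 2 * (1 / 2) ^ k - (1 / 2) ^ (k + d)" for k d
  proof (induction d)
    case 0
    then show ?case
      using y(3)[of k] by (simp add: W_0)
  next
    case (Suc d)
    have "sup (W k d) (y (k + Suc d)) \<le> W k d + y (k + Suc d)"
      using W_bounds y by (simp add: add_increasing add_increasing2)
    then have "f (W k (Suc d)) \<le> f (W k d + y (k + Suc d))"
      unfolding W_Suc using W_bounds by (intro f_mono) (auto intro: le_supI1)
    also have "\<dots> \<le> f (W k d) + f (y (k + Suc d))"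
      by (intro f_subadd W_bounds y)
    finally show ?case
      using Suc y(3)[of "k + Suc d"] by simp
  qed
  have "\<forall>k. \<exists>D. \<forall>d\<ge>D. q (W k d - W k D) \<le> \<epsilon> / 8 * (1 / 2) ^ k"
  proof
    fix k
    have "0 < \<epsilon> / 8 * (1 / 2) ^ k"
      using \<open>0 < \<epsilon>\<close> by simp
    from increasing_Cauchy[OF W_inc W_bounds this]
    show "\<exists>D. \<forall>d\<ge>D. q (W k d - W k D) \<le> \<epsilon> / 8 * (1 / 2) ^ k"
      by blast
  qed
  then obtain D where D: "\<And>k d. d \<ge> D k \<Longrightarrow> q (W k d - W k (D k)) \<le> \<epsilon> / 8 * (1 / 2) ^ k"
    by metis
  \<comment> \<open>\<open>a k\<close> stands in for the supremum of all \<open>y j\<close> with \<open>j \<ge> k\<close>, which need not exist, and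
    \<open>p k\<close> is the infimum of \<open>a 0, \<dots>, a k\<close>.\<close>
  define a where "a k = W k (D k)" for k
  define p where "p = rec_nat (a 0) (\<lambda>k w. inf w (a (Suc k)))"
  have p_0: "p 0 = a 0" and p_Suc: "p (Suc k) = inf (p k) (a (Suc k))" for k
    by (simp_all add: p_def)
  have p_dec: "decseq p"
    by (simp add: decseq_Suc_iff p_Suc)
  have p_bounds: "0 \<le> p k" "p k \<le> x" for k
    by (induction k) (auto simp: p_0 p_Suc a_def W_bounds intro: le_infI1)
  have p_le_a: "p k \<le> a k" for k
    by (cases k) (simp_all add: p_0 p_Suc)
  have y_minus_a: "q (pprt (y k - a j)) \<le> \<epsilon> / 8 * (1 / 2) ^ j" if "j \<le> k" for j k
  proof -
    define d where "d = max (k - j) (D j)"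
    have "y k \<le> W j d"
      using that by (intro y_le_W) (auto simp: d_def)
    moreover have "a j \<le> W j d"
      unfolding a_def by (intro incseqD[OF W_inc]) (simp add: d_def)
    ultimately have "pprt (y k - a j) \<le> W j d - a j"
      by (intro pprt_le) auto
    then have "q (pprt (y k - a j)) \<le> q (W j d - a j)"
      by (intro mono) auto
    also have "\<dots> \<le> \<epsilon> / 8 * (1 / 2) ^ j"
      unfolding a_def by (rule D) (simp add: d_def)
    finally show ?thesis .
  qed
  have "q (pprt (y k - p i)) \<le> \<epsilon> / 4 - \<epsilon> / 8 * (1 / 2) ^ i" if "i \<le> k" for i k
    using that
  proof (induction i)
    case 0
    then show ?case
      using y_minus_a[of 0 k] by (simp add: p_0)
  next
    case (Suc i)
    have "pprt (y k - p (Suc i)) \<le> pprt (y k - p i) + pprt (y k - a (Suc i))"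
    proof (rule pprt_le)
      have "y k - p (Suc i) = sup (y k - p i) (y k - a (Suc i))"
        by (simp add: p_Suc add_sup_distrib_left)
      also have "\<dots> \<le> pprt (y k - p i) + pprt (y k - a (Suc i))"
        by (intro le_supI add_increasing2 add_increasing le_pprt zero_le_pprt)
      finally show "y k - p (Suc i) \<le> pprt (y k - p i) + pprt (y k - a (Suc i))" .
    qed simp
    then have "q (pprt (y k - p (Suc i))) \<le> q (pprt (y k - p i) + pprt (y k - a (Suc i)))"
      by (intro mono) auto
    also have "\<dots> \<le> q (pprt (y k - p i)) + q (pprt (y k - a (Suc i)))"
      by (intro subadd) auto
    finally show ?case
      using Suc y_minus_a[of "Suc i" k] by simp
  qed
  then have q_y_p: "q (pprt (y k - p k)) \<le> \<epsilon> / 4" for k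
    using \<open>0 < \<epsilon>\<close> by (smt (verit) divide_nonneg_pos mult_nonneg_nonneg order_refl zero_le_divide_1_iff zero_le_power)
  have h_p: "3 * \<epsilon> / 4 \<le> h (m k) (p k)" for k
  proof -
    have "y k \<le> p k + pprt (y k - p k)"
      using le_pprt[of "y k - p k"] by (simp add: algebra_simps)
    then have "h (m k) (y k) \<le> h (m k) (p k + pprt (y k - p k))"
      by (intro h_mono y)
    also have "\<dots> \<le> h (m k) (p k) + h (m k) (pprt (y k - p k))"
      by (intro h_subadd p_bounds) simp
    also have "h (m k) (pprt (y k - p k)) \<le> \<epsilon> / 4"
      using h_le_q[of "pprt (y k - p k)" "m k"] q_y_p[of k] by simp
    finally show ?thesis
      using h_large[of k] by simp
  qed
  obtain K where K: "\<And>k. k \<ge> K \<Longrightarrow> q (p K - p k) \<le> \<epsilon> / 4"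
    using decreasing_Cauchy[OF p_dec p_bounds, of "\<epsilon> / 4"] \<open>0 < \<epsilon>\<close> by auto
  have "\<epsilon> / 2 \<le> \<bar>C (m K)\<bar> * (2 * (1 / 2) ^ k)" if "k \<ge> K" for k
  proof -
    have "0 \<le> p K - p k"
      using decseqD[OF p_dec that] by simp
    then have "h (m K) (p k + (p K - p k)) \<le> h (m K) (p k) + q (p K - p k)"
      using h_subadd[of "p k" "p K - p k" "m K"] h_le_q[of "p K - p k" "m K"] p_bounds[of k] by linarith
    then have "\<epsilon> / 2 \<le> h (m K) (p k)"
      using K[OF that] h_p[of K] by simp
    also have "\<dots> \<le> C (m K) * f (p k)"
      by (intro h_le_f p_bounds)
    also have "\<dots> \<le> \<bar>C (m K)\<bar> * (2 * (1 / 2) ^ k)"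
    proof (rule mult_mono)
      have "f (p k) \<le> f (a k)"
        by (intro f_mono p_bounds p_le_a)
      also have "\<dots> \<le> 2 * (1 / 2) ^ k"
        using f_W[of k "D k"] unfolding a_def by (smt (verit) zero_le_divide_1_iff zero_le_power)
      finally show "f (p k) \<le> 2 * (1 / 2) ^ k" .
      show "0 \<le> f (p k)"
        using f_subadd[of 0 "p k"] f_mono[of 0 "p k"] p_bounds f_subadd[of 0 0] by simp
    qed auto
    finally show ?thesis .
  qed
  moreover have "(\<lambda>k. \<bar>C (m K)\<bar> * (2 * (1 / 2) ^ k)) \<longlonglongrightarrow> \<bar>C (m K)\<bar> * (2 * 0)"
    by (intro tendsto_intros LIMSEQ_realpow_zero) auto
  ultimately have "\<epsilon> / 2 \<le> \<bar>C (m K)\<bar> * (2 * 0)"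
    by (intro tendsto_lowerbound[of "\<lambda>k. \<bar>C (m K)\<bar> * (2 * (1 / 2) ^ k)" _ sequentially])
      (auto simp: eventually_sequentially)
  then show False
    using \<open>0 < \<epsilon>\<close> by simp
qed

text \<open>Each \<open>\<lambda>y. f ((y - a)\<^sup>+)\<close> is convex. Let \<open>\<Phi>\<close> be the sum of these functions over the levels \<open>a\<close> of a fine mesh. The infima of
\<open>\<Phi>\<close> over the convex hulls of the tails of \<open>u\<close> increase to a finite limit. Near-minimisers \<open>v\<close> over a late
tail and \<open>w\<close> over a still later one therefore have a midpoint at which \<open>\<Phi>\<close> is almost as large,
so the defect of convexity is small at every level. Thus \<open>f\<close>, and by uniform absolute continuity
every \<open>h m\<close>, is small at the elements that bound \<open>\<bar>v - w\<bar>\<close> up to a small multiple of \<open>x\<close>.\<close>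

lemma close_convex_combinations:
  fixes u :: "nat \<Rightarrow> 'e" and h :: "nat \<Rightarrow> 'e \<Rightarrow> real"
  assumes u: "\<And>n. 0 \<le> u n" "\<And>n. u n \<le> x"
    and h_add: "\<And>m y z. 0 \<le> y \<Longrightarrow> 0 \<le> z \<Longrightarrow> h m (y + z) = h m y + h m z"
    and h_nonneg: "\<And>m y. 0 \<le> y \<Longrightarrow> 0 \<le> h m y"
    and h_le_q: "\<And>m y. 0 \<le> y \<Longrightarrow> h m y \<le> q y"
    and h_le_f: "\<And>m y. 0 \<le> y \<Longrightarrow> h m y \<le> C m * f y"
    and f_add: "\<And>y z. 0 \<le> y \<Longrightarrow> 0 \<le> z \<Longrightarrow> f (y + z) = f y + f z"
    and f_nonneg: "\<And>y. 0 \<le> y \<Longrightarrow> 0 \<le> f y"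
    and "0 < \<epsilon>"
  obtains p v w where "v \<in> convex hull (u ` {..<p})" "w \<in> convex hull (u ` {p..})"
    "\<And>m. h m (pprt (v - w)) \<le> \<epsilon>" "\<And>m. h m (pprt (w - v)) \<le> \<epsilon>"
proof -
  have mono_if_add: "k y \<le> k z" if "0 \<le> y" "y \<le> z"
    "\<And>y z. 0 \<le> y \<Longrightarrow> 0 \<le> z \<Longrightarrow> k (y + z) = k y + k z" "\<And>y. 0 \<le> y \<Longrightarrow> 0 \<le> k y"
    for k :: "'e \<Rightarrow> real" and y z
    using that(3)[of y "z - y"] that(4)[of "z - y"] that(1,2) by simp
  have h_mono: "h m y \<le> h m z" if "0 \<le> y" "y \<le> z" for m y z
    using that h_add h_nonneg by (rule mono_if_add)
  have f_mono: "f y \<le> f z" if "0 \<le> y" "y \<le> z" for y z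
    using that f_add f_nonneg by (rule mono_if_add)
  have h_sum: "h m (\<Sum>i\<in>I. y i) \<le> (\<Sum>i\<in>I. h m (y i))" if "finite I" "\<And>i. i \<in> I \<Longrightarrow> 0 \<le> y i" for m I and y :: "nat \<Rightarrow> 'e"
    using that
  proof (induction I rule: finite_induct)
    case empty
    then show ?case
      using h_add[of 0 0 m] by simp
  next
    case (insert i I)
    then show ?case
      using h_add[of "y i" "sum y I" m] by (simp add: sum_nonneg)
  qed
  obtain N where N: "0 < N" "q x / real N < \<epsilon> / 2"
    using half_gt_zero[OF \<open>0 < \<epsilon>\<close>] by (rule fine_mesh)
  define s where "s = (1 / real N) *\<^sub>R x"
  have s: "0 \<le> s" "real N *\<^sub>R s = x" "q s \<le> \<epsilon> / 2"
    using N unit_nonneg by (auto simp: s_def scale scaleR_nonneg_nonneg)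
  have is_nonneg: "0 \<le> real i *\<^sub>R s" for i
    using s(1) by (simp add: scaleR_nonneg_nonneg)
  have "0 < \<epsilon> / (2 * real N)"
    using \<open>0 < \<epsilon>\<close> N(1) by simp
  from uniformly_absolutely_continuous[of h C f, OF h_mono eq_refl[OF h_add] h_le_q h_le_f f_mono eq_refl[OF f_add] this]
  obtain \<delta> where "0 < \<delta>"
    and \<delta>: "\<And>y m. 0 \<le> y \<Longrightarrow> y \<le> x \<Longrightarrow> f y < \<delta> \<Longrightarrow> h m y \<le> \<epsilon> / (2 * real N)"
    by blast
  define \<Phi> where "\<Phi> y = (\<Sum>i<N. f (pprt (y - real i *\<^sub>R s)))" for y
  define H where "H n = convex hull (u ` {n..})" for n
  have H_bounds: "0 \<le> y \<and> y \<le> x" if "y \<in> H n" for y n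
  proof -
    have "convex {0..x}"
    proof (rule convexI)
      fix y z :: 'e and a b :: real
      assume yz: "y \<in> {0..x}" "z \<in> {0..x}" and ab: "0 \<le> a" "0 \<le> b" "a + b = 1"
      have "a *\<^sub>R y + b *\<^sub>R z \<le> a *\<^sub>R x + b *\<^sub>R x"
        using yz ab by (intro add_mono scaleR_left_mono) auto
      also have "\<dots> = x"
        using ab(3) by (simp flip: scaleR_add_left)
      finally show "a *\<^sub>R y + b *\<^sub>R z \<in> {0..x}"
        using yz ab by (simp add: scaleR_nonneg_nonneg)
    qed
    then have "H n \<subseteq> {0..x}"
      unfolding H_def using u by (intro hull_minimal) auto
    then show ?thesis
      using that by auto
  qed
  have H_anti: "H n \<subseteq> H m" if "m \<le> n" for m n
    unfolding H_def using that by (intro hull_mono image_mono) simp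
  have u_H: "u n \<in> H n" for n
    unfolding H_def by (intro hull_inc) auto
  have \<Phi>_bounds: "0 \<le> \<Phi> y" "\<Phi> y \<le> real N * f x" if "y \<in> H n" for y n
  proof -
    show "0 \<le> \<Phi> y"
      unfolding \<Phi>_def by (intro sum_nonneg f_nonneg zero_le_pprt)
    have "f (pprt (y - real i *\<^sub>R s)) \<le> f x" for i
      using pprt_diff_le[OF is_nonneg, of y i] H_bounds[OF that] by (intro f_mono) (auto intro: order_trans)
    then show "\<Phi> y \<le> real N * f x"
      unfolding \<Phi>_def using sum_bounded_above[of "{..<N}" "\<lambda>i. f (pprt (y - real i *\<^sub>R s))" "f x"] by simp
  qed
  define \<alpha> where "\<alpha> n = Inf (\<Phi> ` H n)" for n
  have bdd: "bdd_below (\<Phi> ` H n)" for n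
    using \<Phi>_bounds(1) by (intro bdd_belowI2)
  have \<alpha>_le: "\<alpha> n \<le> \<Phi> y" if "y \<in> H n" for n y
    unfolding \<alpha>_def using that bdd by (intro cInf_lower) auto
  have almost_min: "\<exists>y\<in>H n. \<Phi> y < \<alpha> n + \<delta> / 5" for n
  proof -
    have "\<Phi> ` H n \<noteq> {}" "\<alpha> n < \<alpha> n + \<delta> / 5"
      using u_H \<open>0 < \<delta>\<close> by auto
    then show ?thesis
      unfolding \<alpha>_def using cInf_lessD[of "\<Phi> ` H n"] by blast
  qed
  have \<alpha>_bdd: "bdd_above (range \<alpha>)"
    using order_trans[OF \<alpha>_le[OF u_H] \<Phi>_bounds(2)[OF u_H]] by (intro bdd_aboveI2)
  define L where "L = Sup (range \<alpha>)"
  have \<alpha>_le_L: "\<alpha> n \<le> L" for n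
    unfolding L_def using \<alpha>_bdd by (intro cSup_upper) auto
  obtain n where n: "L - \<delta> / 5 < \<alpha> n"
    using less_cSupD[of "range \<alpha>" "L - \<delta> / 5"] \<open>0 < \<delta>\<close> by (auto simp: L_def)
  obtain v where v: "v \<in> H n" "\<Phi> v < \<alpha> n + \<delta> / 5"
    using almost_min by blast
  \<comment> \<open>\<open>v\<close> uses only finitely many of the \<open>u n\<close>; \<open>w\<close> is taken from the tail beyond them.\<close>
  obtain p where p: "n \<le> p" "v \<in> convex hull (u ` {..<p})"
  proof -
    obtain A where A: "finite A" "A \<subseteq> u ` {n..}" "v \<in> convex hull A"
      using v(1) unfolding H_def convex_hull_explicit[of "u ` {n..}"] by (force simp: convex_hull_finite)
    then obtain I where I: "finite I" "A = u ` I"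
      by (meson finite_subset_image)
    define p where "p = max n (Suc (Max (insert 0 I)))"
    have "I \<subseteq> {..<p}"
      using I(1) by (auto simp: p_def less_Suc_eq_le less_max_iff_disj)
    then have "convex hull A \<subseteq> convex hull (u ` {..<p})"
      unfolding I(2) by (intro hull_mono image_mono)
    then show thesis
      using that[of p] A(3) by (auto simp: p_def)
  qed
  obtain w where w: "w \<in> H p" "\<Phi> w < \<alpha> p + \<delta> / 5"
    using almost_min by blast
  have w_H: "w \<in> H n"
    using H_anti[OF p(1)] w(1) by blast
  define c where "c = (1 / 2) *\<^sub>R v + (1 / 2) *\<^sub>R w"
  have "c \<in> H n"
    unfolding c_def H_def by (rule convexD[OF convex_convex_hull]) (use v(1) w_H in \<open>auto simp: H_def\<close>)
  then have gap: "\<Phi> v + \<Phi> w - 2 * \<Phi> c < \<delta>"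
    using v(2) w(2) n \<alpha>_le[of c n] \<alpha>_le_L[of n] \<alpha>_le_L[of p] \<open>0 < \<delta>\<close> by linarith
  have close: "h m (pprt (a - b)) \<le> \<epsilon>"
    if ab: "a \<in> H n" "b \<in> H n" and c: "c = (1 / 2) *\<^sub>R a + (1 / 2) *\<^sub>R b"
      and gap: "\<Phi> a + \<Phi> b - 2 * \<Phi> c < \<delta>" for a b m
  proof -
    let ?t = "\<lambda>i. straddle b a (real i *\<^sub>R s)"
    have term_le: "f (?t i) + 2 * f (pprt (c - real i *\<^sub>R s)) \<le> f (pprt (a - real i *\<^sub>R s)) + f (pprt (b - real i *\<^sub>R s))" for i
    proof -
      let ?c = "pprt (c - real i *\<^sub>R s)"
      have "f (?t i + 2 *\<^sub>R ?c) \<le> f (pprt (a - real i *\<^sub>R s) + pprt (b - real i *\<^sub>R s))"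
        unfolding c by (intro f_mono straddle_add_pprt_le add_nonneg_nonneg straddle_nonneg scaleR_nonneg_nonneg) auto
      moreover have "f (2 *\<^sub>R ?c) = 2 * f ?c"
        using f_add[of ?c ?c] by (simp add: scaleR_2)
      ultimately show ?thesis
        by (simp add: f_add straddle_nonneg scaleR_nonneg_nonneg)
    qed
    have sum_le: "(\<Sum>i<N. f (?t i)) + 2 * \<Phi> c \<le> \<Phi> a + \<Phi> b"
      unfolding \<Phi>_def sum_distrib_left sum.distrib[symmetric] by (intro sum_mono term_le)
    have h_t: "h m (?t i) \<le> \<epsilon> / (2 * real N)" if "i < N" for i
    proof (rule \<delta>)
      have "f (?t i) \<le> (\<Sum>i<N. f (?t i))"
        using that by (intro member_le_sum f_nonneg straddle_nonneg) auto
      then show "f (?t i) < \<delta>"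
        using sum_le gap by linarith
      show "?t i \<le> x"
        using straddle_le[OF is_nonneg] H_bounds[OF ab(1)] by (meson order_trans)
    qed (rule straddle_nonneg)
    have "pprt (a - b) \<le> s + (\<Sum>i<N. ?t i)"
      using H_bounds ab s by (intro pprt_diff_le_straddle_sum) auto
    then have "h m (pprt (a - b)) \<le> h m (s + (\<Sum>i<N. ?t i))"
      by (intro h_mono) auto
    also have "\<dots> = h m s + h m (\<Sum>i<N. ?t i)"
      by (intro h_add s sum_nonneg straddle_nonneg)
    also have "h m (\<Sum>i<N. ?t i) \<le> (\<Sum>i<N. h m (?t i))"
      by (intro h_sum straddle_nonneg) auto
    also have "\<dots> \<le> (\<Sum>i<N. \<epsilon> / (2 * real N))"
      by (intro sum_mono h_t) auto
    also have "\<dots> = \<epsilon> / 2"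
      using N(1) by simp
    finally show ?thesis
      using h_le_q[OF s(1), of m] s(3) by simp
  qed
  show thesis
  proof
    show "w \<in> convex hull (u ` {p..})"
      using w(1) by (simp add: H_def)
    show "h m (pprt (v - w)) \<le> \<epsilon>" for m
      using v(1) w_H c_def gap by (rule close)
    have "c = (1 / 2) *\<^sub>R w + (1 / 2) *\<^sub>R v" "\<Phi> w + \<Phi> v - 2 * \<Phi> c < \<delta>"
      using gap by (simp_all add: c_def add.commute)
    with w_H v(1) show "h m (pprt (w - v)) \<le> \<epsilon>" for m
      by (rule close)
  qed (rule p(2))
qed

end

section \<open>Order weakly compact operators\<close>

lemma norm_mono_nonneg: "0 \<le> w \<Longrightarrow> w \<le> z \<Longrightarrow> norm w \<le> norm (z :: 'e::banach_lattice)"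
  by (rule norm_mono_modulus) (simp add: abs_of_nonneg order_trans[of 0 w z])

lemma Riesz_decomposition:
  fixes w y z :: "'e::lattice_ab_group_add"
  assumes "0 \<le> w" "w \<le> y + z" "0 \<le> y" "0 \<le> z"
  obtains w1 w2 where "w = w1 + w2" "0 \<le> w1" "w1 \<le> y" "0 \<le> w2" "w2 \<le> z"
proof
  show "w = inf w y + (w - inf w y)"
    by (simp only: add_diff_cancel_left' add_diff_eq)
  show "0 \<le> inf w y" "inf w y \<le> y" "0 \<le> w - inf w y"
    using assms by (simp_all del: diff_inf_eq_sup)
  have "w \<le> inf w y + z"
    using assms by (simp add: add_inf_distrib_right)
  then show "w - inf w y \<le> z"
    by (simp add: diff_le_eq add.commute del: diff_inf_eq_sup)
qed

text \<open>For linear \<open>g\<close> this is the Riesz-Kantorovich formula for the positive part of \<open>g\<close>; for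
  \<open>g = (\<lambda>w. norm (T w))\<close> it is the smallest monotone majorant on the positive cone.\<close>

definition interval_sup :: "('e::banach_lattice \<Rightarrow> real) \<Rightarrow> 'e \<Rightarrow> real" where
  "interval_sup g z = (SUP w\<in>{0..z}. g w)"

text \<open>This covers both bounded linear functionals and \<open>\<lambda>w. norm (T w)\<close>.\<close>

locale bounded_sublinear =
  fixes g :: "'e::banach_lattice \<Rightarrow> real" and C :: real
  assumes g_bound: "\<And>w. g w \<le> C * norm w" and C_nonneg: "0 \<le> C"
    and g_subadd: "\<And>v w. g (v + w) \<le> g v + g w"
    and g_scale: "\<And>c w. 0 \<le> c \<Longrightarrow> g (c *\<^sub>R w) = c * g w"
begin

lemma bdd_above_interval: "bdd_above (g ` {0..z})"
proof (rule bdd_aboveI2)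
  fix w assume "w \<in> {0..z}"
  then have "C * norm w \<le> C * norm z"
    using C_nonneg by (intro mult_left_mono norm_mono_nonneg) auto
  then show "g w \<le> C * norm z"
    using g_bound order_trans by blast
qed

lemma le_interval_sup: "0 \<le> w \<Longrightarrow> w \<le> z \<Longrightarrow> g w \<le> interval_sup g z"
  unfolding interval_sup_def by (intro cSUP_upper bdd_above_interval) simp

lemma interval_sup_le: "0 \<le> z \<Longrightarrow> (\<And>w. 0 \<le> w \<Longrightarrow> w \<le> z \<Longrightarrow> g w \<le> B) \<Longrightarrow> interval_sup g z \<le> B"
  unfolding interval_sup_def by (intro cSUP_least) auto

lemma interval_sup_nonneg: "0 \<le> z \<Longrightarrow> 0 \<le> interval_sup g z"
  using le_interval_sup[of 0 z] g_scale[of 0 0] by simp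

lemma interval_sup_mono: "0 \<le> y \<Longrightarrow> y \<le> z \<Longrightarrow> interval_sup g y \<le> interval_sup g z"
  by (intro interval_sup_le le_interval_sup) (auto intro: order_trans)

lemma interval_sup_subadd:
  assumes "0 \<le> y" "0 \<le> z"
  shows "interval_sup g (y + z) \<le> interval_sup g y + interval_sup g z"
proof (rule interval_sup_le)
  fix w assume "0 \<le> w" "w \<le> y + z"
  then obtain w1 w2 where "w = w1 + w2" "0 \<le> w1" "w1 \<le> y" "0 \<le> w2" "w2 \<le> z"
    using assms by (rule Riesz_decomposition)
  then show "g w \<le> interval_sup g y + interval_sup g z"
    using g_subadd[of w1 w2] le_interval_sup[of w1 y] le_interval_sup[of w2 z] by simp
qed (use assms in simp)

lemma interval_sup_scale:
  assumes "0 \<le> c" "0 \<le> y"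
  shows "interval_sup g (c *\<^sub>R y) = c * interval_sup g y"
proof (cases "c = 0")
  case True
  then show ?thesis
    using g_scale[of 0 0] by (simp add: interval_sup_def)
next
  case False
  then have "c > 0"
    using assms by simp
  have le: "interval_sup g (b *\<^sub>R y) \<le> b * interval_sup g y" if "b > 0" "0 \<le> y" for b y
  proof (rule interval_sup_le)
    fix w assume w: "0 \<le> w" "w \<le> b *\<^sub>R y"
    have "inverse b *\<^sub>R w \<le> inverse b *\<^sub>R (b *\<^sub>R y)"
      using w \<open>b > 0\<close> by (intro scaleR_left_mono) auto
    then have "g (inverse b *\<^sub>R w) \<le> interval_sup g y"
      using w \<open>b > 0\<close> by (intro le_interval_sup scaleR_nonneg_nonneg) auto
    then have "b * g (inverse b *\<^sub>R w) \<le> b * interval_sup g y"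
      using \<open>b > 0\<close> by (intro mult_left_mono) auto
    then show "g w \<le> b * interval_sup g y"
      using g_scale[of b "inverse b *\<^sub>R w"] \<open>b > 0\<close> by simp
  qed (use that in \<open>simp add: scaleR_nonneg_nonneg\<close>)
  have "interval_sup g (inverse c *\<^sub>R (c *\<^sub>R y)) \<le> inverse c * interval_sup g (c *\<^sub>R y)"
    using \<open>c > 0\<close> assms by (intro le scaleR_nonneg_nonneg) auto
  then have "c * interval_sup g y \<le> interval_sup g (c *\<^sub>R y)"
    using \<open>c > 0\<close> by (simp add: field_simps)
  then show ?thesis
    using le[OF \<open>c > 0\<close> assms(2)] by (intro antisym)
qed

text \<open>Any sum of members of \<open>{0..y}\<close> and \<open>{0..z}\<close> lies in \<open>{0..y + z}\<close>, and the Riesz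
decomposition gives the converse.\<close>

lemma interval_sup_add:
  assumes "0 \<le> y" "0 \<le> z" and g_add: "\<And>v w. g (v + w) = g v + g w"
  shows "interval_sup g (y + z) = interval_sup g y + interval_sup g z"
proof (rule antisym)
  have "interval_sup g y \<le> interval_sup g (y + z) - g w" if w: "0 \<le> w" "w \<le> z" for w
  proof (rule interval_sup_le)
    fix v assume "0 \<le> v" "v \<le> y"
    then have "g (v + w) \<le> interval_sup g (y + z)"
      using w by (intro le_interval_sup add_nonneg_nonneg add_mono)
    then show "g v \<le> interval_sup g (y + z) - g w"
      by (simp add: g_add)
  qed (rule assms(1))
  then have "interval_sup g z \<le> interval_sup g (y + z) - interval_sup g y"
    using assms(2) by (intro interval_sup_le) (auto simp: algebra_simps)
  then show "interval_sup g y + interval_sup g z \<le> interval_sup g (y + z)"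
    by simp
qed (use assms in \<open>intro interval_sup_subadd\<close>)

end

text \<open>If \<open>T ` {0..x}\<close> is not relatively weakly compact, there are functionals that separate early from late convex
combinations of some sequence in \<open>{0..x}\<close>. Their moduli are dominated by the monotone seminorm generated by
\<open>T\<close>, which vanishes along disjoint sequences, so some early and some late convex combination are too
close to be separated.\<close>

lemma order_weakly_compactI:
  fixes T :: "'e::banach_lattice \<Rightarrow> 'f::banach"
  assumes "bounded_linear T"
    and null: "\<And>z x. (\<And>n. 0 \<le> z n) \<Longrightarrow> (\<And>n. z n \<le> x) \<Longrightarrow> disjoint_seq z \<Longrightarrow> (\<lambda>n. T (z n)) \<longlonglongrightarrow> 0"
  shows "order_weakly_compact T"
  unfolding order_weakly_compact_def
proof (intro allI impI, rule ccontr)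
  fix x :: 'e assume "0 \<le> x" and not_rwc: "\<not> relatively_weakly_compact (T ` {0..x})"
  interpret T: bounded_linear T
    by fact
  obtain B where B: "0 \<le> B" "\<And>w. norm (T w) \<le> B * norm w"
    using T.nonneg_bounded by (auto simp: mult.commute)
  have T_interval: "norm (T w) \<le> B * norm x" if "w \<in> {0..x}" for w
    using B(2)[of w] mult_left_mono[OF norm_mono_nonneg[of w x] B(1)] that by auto
  then have "bounded (T ` {0..x})"
    unfolding bounded_iff by blast
  then obtain \<theta> y and \<phi> :: "nat \<Rightarrow> 'f \<Rightarrow>\<^sub>L real" where "0 < \<theta>"
    and y: "\<And>n. y n \<in> T ` {0..x}" and \<phi>: "\<And>n. norm (\<phi> n) \<le> 1"
    and before: "\<And>i n. i < n \<Longrightarrow> blinfun_apply (\<phi> n) (y i) = 0"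
    and after: "\<And>i n. n \<le> i \<Longrightarrow> \<theta> \<le> blinfun_apply (\<phi> n) (y i)"
    using not_relatively_weakly_compact_imp_separated[OF _ not_rwc] by metis
  have "\<forall>n. \<exists>u. u \<in> {0..x} \<and> y n = T u"
    using y by blast
  then obtain u where u: "\<And>n. u n \<in> {0..x}" "\<And>n. y n = T (u n)"
    by metis
  define r where "r = interval_sup (\<lambda>w. norm (T w))"
  \<comment> \<open>The factor \<open>2\<close> makes \<open>q\<close> dominate the moduli \<open>h m\<close>, sums of a positive and a negative part
    each dominated by \<open>r\<close>.\<close>
  define q where "q z = 2 * r z" for z
  interpret r: bounded_sublinear "\<lambda>w. norm (T w)" B
    by standard (simp_all add: B T.add norm_triangle_ineq T.scaleR)
  interpret q: disjointly_null_seminorm q x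
  proof
    show "q y \<le> q z" if "0 \<le> y" "y \<le> z" for y z
      using r.interval_sup_mono[OF that] by (simp add: q_def r_def)
    show "q (y + z) \<le> q y + q z" if "0 \<le> y" "0 \<le> z" for y z
      using r.interval_sup_subadd[OF that] by (simp add: q_def r_def)
    show "q (c *\<^sub>R y) = c * q y" if "0 \<le> c" "0 \<le> y" for c y
      using r.interval_sup_scale[OF that] by (simp add: q_def r_def)
    fix w :: "nat \<Rightarrow> 'e" assume w: "\<And>n. 0 \<le> w n" "\<And>n. w n \<le> x" "disjoint_seq w"
    \<comment> \<open>\<open>r (w n)\<close> is almost attained at some \<open>v n\<close> below \<open>w n\<close>, and the \<open>v n\<close> are again disjoint.\<close>
    have "\<exists>v. 0 \<le> v \<and> v \<le> w n \<and> r (w n) \<le> norm (T v) + inverse (real (Suc n))" for n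
    proof (rule ccontr)
      assume no: "\<not> ?thesis"
      have "norm (T v) \<le> r (w n) - inverse (real (Suc n))" if "0 \<le> v" "v \<le> w n" for v
      proof (rule ccontr)
        assume "\<not> norm (T v) \<le> r (w n) - inverse (real (Suc n))"
        then have "r (w n) \<le> norm (T v) + inverse (real (Suc n))"
          by linarith
        then show False
          using no that by blast
      qed
      then have "r (w n) \<le> r (w n) - inverse (real (Suc n))"
        using r.interval_sup_le[OF w(1)] unfolding r_def by blast
      then show False
        by simp
    qed
    then obtain v where v: "\<And>n. 0 \<le> v n" "\<And>n. v n \<le> w n"
        "\<And>n. r (w n) \<le> norm (T (v n)) + inverse (real (Suc n))"
      by metis
    have "(\<lambda>n. T (v n)) \<longlonglongrightarrow> 0"
    proof (rule null)
      show "disjoint_seq v"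
        unfolding disjoint_seq_def
      proof (intro allI impI)
        fix j k :: nat assume "j \<noteq> k"
        then have "inf (w j) (w k) = 0"
          using w by (simp add: disjoint_seq_def abs_of_nonneg)
        then show "inf \<bar>v j\<bar> \<bar>v k\<bar> = 0"
          using inf_mono_eq_0[of "w j" "w k" "v j" "v k"] v by (simp add: abs_of_nonneg)
      qed
      show "v n \<le> x" for n
        using v(2) w(2) by (rule order_trans)
    qed (rule v(1))
    then have "(\<lambda>n. 2 * (norm (T (v n)) + inverse (real (Suc n)))) \<longlonglongrightarrow> 2 * (0 + 0)"
      by (intro tendsto_intros tendsto_norm_zero LIMSEQ_inverse_real_of_nat)
    then have lim: "(\<lambda>n. 2 * (norm (T (v n)) + inverse (real (Suc n)))) \<longlonglongrightarrow> 0"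
      by simp
    show "(\<lambda>n. q (w n)) \<longlonglongrightarrow> 0"
      using tendsto_const lim
    proof (rule tendsto_sandwich[rotated 2])
      show "\<forall>\<^sub>F n in sequentially. 0 \<le> q (w n)"
        using r.interval_sup_nonneg[OF w(1)] by (simp add: q_def r_def)
      show "\<forall>\<^sub>F n in sequentially. q (w n) \<le> 2 * (norm (T (v n)) + inverse (real (Suc n)))"
        unfolding q_def using v(3) by (intro always_eventually allI mult_left_mono) auto
    qed
  qed (rule \<open>0 \<le> x\<close>)
  define g where "g m w = blinfun_apply (\<phi> m) (T w)" for m w
  have g_le_T: "\<bar>g m w\<bar> \<le> norm (T w)" for m w
    using norm_blinfun[of "\<phi> m" "T w"] mult_right_mono[OF \<phi>[of m] norm_ge_zero[of "T w"]]
    by (simp add: g_def)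
  have g_linear: "linear (g m)" for m
    unfolding g_def by (intro linearI) (simp_all add: T.add T.scaleR blinfun.add_right blinfun.scaleR_right)
  have pos: "bounded_sublinear (g m) B" and neg: "bounded_sublinear (\<lambda>w. - g m w) B" for m
  proof -
    have "\<bar>g m w\<bar> \<le> B * norm w" for w
      using g_le_T B(2) by (rule order_trans)
    then show "bounded_sublinear (g m) B" "bounded_sublinear (\<lambda>w. - g m w) B"
      by (auto simp: bounded_sublinear_def B(1) abs_le_iff linear_add[OF g_linear] linear_scale[OF g_linear])
  qed
  \<comment> \<open>\<open>h m\<close> is the modulus of \<open>g m\<close>, and \<open>f\<close> a positive functional that controls all of them.\<close>
  define h where "h m z = interval_sup (g m) z + interval_sup (\<lambda>w. - g m w) z" for m z
  have h_add: "h m (y + z) = h m y + h m z" if "0 \<le> y" "0 \<le> z" for m y z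
    using bounded_sublinear.interval_sup_add[OF pos that, of m] bounded_sublinear.interval_sup_add[OF neg that, of m]
    by (simp add: h_def linear_add[OF g_linear])
  have h_nonneg: "0 \<le> h m z" if "0 \<le> z" for m z
    unfolding h_def using bounded_sublinear.interval_sup_nonneg[OF pos that] bounded_sublinear.interval_sup_nonneg[OF neg that]
    by (intro add_nonneg_nonneg)
  have g_le_h: "\<bar>g m z\<bar> \<le> h m z" if "0 \<le> z" for m z
    using bounded_sublinear.le_interval_sup[OF pos that order_refl, of m] bounded_sublinear.le_interval_sup[OF neg that order_refl, of m]
      bounded_sublinear.interval_sup_nonneg[OF pos that, of m] bounded_sublinear.interval_sup_nonneg[OF neg that, of m]
    by (simp add: h_def abs_le_iff)
  have h_le_q: "h m z \<le> q z" if "0 \<le> z" for m z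
  proof -
    have "g m w \<le> r z" "- g m w \<le> r z" if "0 \<le> w" "w \<le> z" for w
      using g_le_T[of m w] r.le_interval_sup[OF that] by (simp_all add: r_def abs_le_iff)
    then have "interval_sup (g m) z \<le> r z" "interval_sup (\<lambda>w. - g m w) z \<le> r z"
      using bounded_sublinear.interval_sup_le[OF pos that] bounded_sublinear.interval_sup_le[OF neg that] by blast+
    then show ?thesis
      by (simp add: h_def q_def)
  qed
  define f where "f z = (\<Sum>m. (1 / 2) ^ m * h m z)" for z
  have summable_h: "summable (\<lambda>m. (1 / 2) ^ m * h m z)" if "0 \<le> z" for z
  proof (rule summable_comparison_test')
    show "summable (\<lambda>m. (1 / 2) ^ m * q z)"
      by (intro summable_mult2 summable_geometric) simp
    show "norm ((1 / 2) ^ m * h m z) \<le> (1 / 2) ^ m * q z" for m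
      using h_le_q[OF that, of m] h_nonneg[OF that, of m] by (simp add: abs_mult mult_left_mono)
  qed
  have f_add: "f (y + z) = f y + f z" if "0 \<le> y" "0 \<le> z" for y z
    using suminf_add[OF summable_h[OF that(1)] summable_h[OF that(2)]]
    by (simp add: f_def h_add[OF that] distrib_left)
  have f_nonneg: "0 \<le> f z" if "0 \<le> z" for z
    unfolding f_def using h_nonneg[OF that] by (intro suminf_nonneg summable_h[OF that]) simp
  have h_le_f: "h m z \<le> 2 ^ m * f z" if "0 \<le> z" for m z
  proof -
    have "(\<Sum>i\<in>{m}. (1 / 2) ^ i * h i z) \<le> f z"
      unfolding f_def using h_nonneg[OF that] by (intro sum_le_suminf summable_h[OF that]) auto
    then show ?thesis
      by (simp add: field_simps)
  qed
  have "0 < \<theta> / 4"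
    using \<open>0 < \<theta>\<close> by simp
  have u_bounds: "0 \<le> u n" "u n \<le> x" for n
    using u(1)[of n] by auto
  obtain p v w where vw: "v \<in> convex hull (u ` {..<p})" "w \<in> convex hull (u ` {p..})"
    and h_small: "\<And>m. h m (pprt (v - w)) \<le> \<theta> / 4" "\<And>m. h m (pprt (w - v)) \<le> \<theta> / 4"
    by (rule q.close_convex_combinations[of u h "\<lambda>m. 2 ^ m" f, OF u_bounds h_add h_nonneg h_le_q h_le_f
          f_add f_nonneg \<open>0 < \<theta> / 4\<close>]) (assumption | (rule that; assumption))+
  have "g p v = 0"
  proof -
    have "convex {z. g p z = 0}"
      by (rule subspace_imp_convex) (rule linear_subspace_kernel[OF g_linear])
    then have "convex hull (u ` {..<p}) \<subseteq> {z. g p z = 0}"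
      by (rule hull_minimal[rotated]) (use before u(2) in \<open>auto simp: g_def\<close>)
    then show ?thesis
      using vw(1) by blast
  qed
  moreover have "\<theta> \<le> g p w"
  proof -
    have "convex (g p -` {\<theta>..})"
      by (intro convex_linear_vimage g_linear convex_real_interval)
    then have "convex hull (u ` {p..}) \<subseteq> g p -` {\<theta>..}"
      by (rule hull_minimal[rotated]) (use after u(2) in \<open>auto simp: g_def\<close>)
    then show ?thesis
      using vw(2) by blast
  qed
  moreover have "g p w - g p v = g p (pprt (w - v)) - g p (pprt (v - w))"
  proof -
    have "w - v = pprt (w - v) - pprt (v - w)"
    proof -
      have "nprt (w - v) = - pprt (v - w)"
        using nprt_neg[of "v - w"] by (simp only: minus_diff_eq)
      then show ?thesis
        using prts[of "w - v"] by (metis add_uminus_conv_diff)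
    qed
    then show ?thesis
      by (metis linear_diff[OF g_linear])
  qed
  ultimately show False
    using g_le_h[of "pprt (w - v)" p] g_le_h[of "pprt (v - w)" p] h_small[of p] \<open>0 < \<theta>\<close>
    by (simp add: abs_le_iff)
qed

section \<open>Disjoint and order bounded sequences\<close>

lemma order_bounded_seq_imp_abs_le:
  assumes "order_bounded_seq x"
  obtains z where "\<And>j. \<bar>x j\<bar> \<le> z"
proof -
  obtain a b where "\<And>j. a \<le> x j" "\<And>j. x j \<le> b"
    using assms by (auto simp: order_bounded_seq_def)
  then have "\<bar>x j\<bar> \<le> \<bar>a\<bar> + \<bar>b\<bar>" for j
    by (intro abs_leI)
      (meson abs_ge_self abs_ge_zero add_increasing order_trans,
       meson abs_ge_minus_self abs_ge_zero add_increasing2 neg_le_iff_le order_trans)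
  then show thesis
    by (rule that)
qed

lemma order_bounded_seqI:
  assumes "\<And>j. \<bar>x j\<bar> \<le> z"
  shows "order_bounded_seq x"
  unfolding order_bounded_seq_def
proof (rule exI[of _ "- z"], rule exI[of _ z], intro allI conjI)
  fix j
  show "- z \<le> x j"
    using order_trans[OF abs_ge_minus_self assms[of j]] by (simp add: minus_le_iff)
  show "x j \<le> z"
    using abs_ge_self assms by (rule order_trans)
qed

lemma disjoint_inf_sum_eq_0:
  fixes y :: "nat \<Rightarrow> 'e::banach_lattice"
  assumes "disjoint_seq y" "finite I" "k \<notin> I"
  shows "inf (\<Sum>j\<in>I. \<bar>y j\<bar>) \<bar>y k\<bar> = 0"
  using assms(2,3)
proof (induction I rule: finite_induct)
  case empty
  then show ?case by (simp add: inf_absorb1)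
next
  case (insert i I)
  then show ?case
    using assms(1) by (simp add: inf_add_eq_0 sum_nonneg disjoint_seq_def)
qed

lemma sup_eq_add_if_disjoint: "inf a b = 0 \<Longrightarrow> sup a b = a + (b :: 'e::lattice_ab_group_add)"
  using add_eq_inf_sup[of a b] by simp

lemma abs_add_if_disjoint:
  fixes a b :: "'e::banach_lattice"
  assumes "inf \<bar>a\<bar> \<bar>b\<bar> = 0"
  shows "\<bar>a\<bar> + \<bar>b\<bar> \<le> \<bar>a + b\<bar>"
proof -
  have parts: "inf \<bar>a\<bar> \<bar>a + b\<bar> \<ge> \<bar>a\<bar>" if "inf \<bar>a\<bar> \<bar>b\<bar> = 0" for a b :: 'e
  proof -
    have "\<bar>a\<bar> \<le> \<bar>a + b\<bar> + \<bar>b\<bar>"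
      using abs_triangle_ineq[of "a + b" "- b"] by simp
    then have "\<bar>a\<bar> = inf (\<bar>a + b\<bar> + \<bar>b\<bar>) \<bar>a\<bar>"
      by (simp add: inf_absorb2)
    also have "\<dots> \<le> inf \<bar>a + b\<bar> \<bar>a\<bar> + inf \<bar>b\<bar> \<bar>a\<bar>"
      by (intro inf_add_le) auto
    also have "\<dots> = inf \<bar>a\<bar> \<bar>a + b\<bar>"
      using that by (simp add: inf.commute)
    finally show ?thesis .
  qed
  have "\<bar>a\<bar> \<le> \<bar>a + b\<bar>"
    using parts[OF assms] by simp
  moreover have "\<bar>b\<bar> \<le> \<bar>a + b\<bar>"
    using parts[of b a] assms by (simp add: inf.commute add.commute)
  ultimately show ?thesis
    using sup_eq_add_if_disjoint[OF assms] by (metis le_supI)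
qed

lemma abs_scaleR_lattice: "\<bar>c *\<^sub>R v\<bar> = \<bar>c\<bar> *\<^sub>R \<bar>v :: 'e::banach_lattice\<bar>"
proof -
  have nonneg: "\<bar>c *\<^sub>R v\<bar> = c *\<^sub>R \<bar>v\<bar>" if "0 \<le> c" for c
  proof -
    have eq: "\<bar>w\<bar> = pprt w + pprt (- w)" for w :: 'e
      by (simp add: abs_prts pprt_neg)
    show ?thesis
      unfolding eq scaleR_add_right scaleR_pprt[OF that] by simp
  qed
  show ?thesis
  proof (cases "0 \<le> c")
    case False
    then show ?thesis
      using nonneg[of "- c"] by simp
  qed (simp add: nonneg)
qed

lemma disjoint_seq_scaleR:
  assumes "disjoint_seq y"
  shows "disjoint_seq (\<lambda>j. a j *\<^sub>R y j)"
  using assms by (simp add: disjoint_seq_def abs_scaleR_lattice inf_scaleR_eq_0)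

text \<open>With \<open>disjoint_seq_scaleR\<close> this shows that the norm of a linear combination of disjoint elements
depends only on the moduli of the elements and coefficients.\<close>

lemma abs_sum_disjoint:
  fixes y :: "nat \<Rightarrow> 'e::banach_lattice"
  assumes "disjoint_seq y"
  shows "\<bar>\<Sum>j<n. y j\<bar> = (\<Sum>j<n. \<bar>y j\<bar>)"
proof (induction n)
  case (Suc n)
  have "inf \<bar>\<Sum>j<n. y j\<bar> \<bar>y n\<bar> = 0"
    using disjoint_inf_sum_eq_0[OF assms, of "{..<n}" n] Suc by simp
  then have "(\<Sum>j<Suc n. \<bar>y j\<bar>) \<le> \<bar>\<Sum>j<Suc n. y j\<bar>"
    using abs_add_if_disjoint[of "\<Sum>j<n. y j" "y n"] Suc by simp
  then show ?case
    by (intro antisym sum_abs)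
qed simp

text \<open>The sum of disjoint positive elements is their supremum.\<close>

lemma sum_disjoint_le:
  fixes y :: "nat \<Rightarrow> 'e::banach_lattice"
  assumes "disjoint_seq y" "\<And>j. \<bar>y j\<bar> \<le> z" "0 \<le> z"
  shows "(\<Sum>j<n. \<bar>y j\<bar>) \<le> z"
proof (induction n)
  case (Suc n)
  have "(\<Sum>j<Suc n. \<bar>y j\<bar>) = sup (\<Sum>j<n. \<bar>y j\<bar>) \<bar>y n\<bar>"
    using disjoint_inf_sum_eq_0[OF assms(1), of "{..<n}" n] by (simp add: sup_eq_add_if_disjoint)
  then show ?case
    using Suc assms(2) by simp
qed (simp add: assms)

text \<open>With signs chosen to match those of \<open>\<phi> (y j)\<close>, the partial sums of \<open>y\<close> stay below
\<open>z\<close> in modulus. Hence the series of the \<open>\<bar>\<phi> (y j)\<bar>\<close> converges.\<close>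

lemma disjoint_order_bounded_weakly_null:
  fixes y :: "nat \<Rightarrow> 'e::banach_lattice"
  assumes y: "disjoint_seq y" "\<And>j. \<bar>y j\<bar> \<le> z"
  shows "weakly_null y"
  unfolding weakly_null_iff
proof (intro allI impI)
  fix \<phi> :: "'e \<Rightarrow> real" assume "bounded_linear \<phi>"
  then interpret bounded_linear \<phi> .
  obtain C where C: "0 \<le> C" "\<And>v. \<bar>\<phi> v\<bar> \<le> C * norm v"
    using nonneg_bounded by (auto simp: mult.commute)
  have "0 \<le> z"
    using abs_ge_zero y(2) by (rule order_trans)
  have "(\<Sum>j<n. \<bar>\<phi> (y j)\<bar>) \<le> C * norm z" for n
  proof -
    define v where "v = (\<Sum>j<n. sgn (\<phi> (y j)) *\<^sub>R y j)"
    have "\<bar>v\<bar> = (\<Sum>j<n. \<bar>sgn (\<phi> (y j)) *\<^sub>R y j\<bar>)"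
      unfolding v_def by (intro abs_sum_disjoint disjoint_seq_scaleR y)
    also have "\<dots> \<le> (\<Sum>j<n. \<bar>y j\<bar>)"
      by (intro sum_mono) (simp add: abs_scaleR_lattice abs_sgn_eq)
    also have "\<dots> \<le> z"
      by (rule sum_disjoint_le[OF y \<open>0 \<le> z\<close>])
    finally have "norm v \<le> norm z"
      by (intro norm_mono_modulus) (simp add: \<open>0 \<le> z\<close> abs_of_nonneg)
    have "(\<Sum>j<n. \<bar>\<phi> (y j)\<bar>) = \<phi> v"
      by (simp add: v_def sum scaleR abs_sgn mult.commute)
    also have "\<dots> \<le> C * norm v"
      using C(2)[of v] by simp
    also have "\<dots> \<le> C * norm z"
      using \<open>norm v \<le> norm z\<close> C(1) by (rule mult_left_mono)
    finally show ?thesis .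
  qed
  then have "summable (\<lambda>j. \<bar>\<phi> (y j)\<bar>)"
    by (intro bounded_imp_summable[where B = "C * norm z"])
      (simp, simp only: lessThan_Suc_atMost[symmetric])
  then show "(\<lambda>j. \<phi> (y j)) \<longlonglongrightarrow> 0"
    using summable_LIMSEQ_zero tendsto_rabs_zero_iff by blast
qed

text \<open>For disjoint \<open>x j\<close>, replacing them by \<open>\<bar>x j\<bar>\<close> does not change the norms of linear
combinations. So for each \<open>f\<close> the values \<open>f \<bar>x j\<bar>\<close> are also the values at \<open>x j\<close> of
some bounded functional, and these tend to \<open>0\<close>.\<close>

lemma disjoint_weakly_null_abs:
  fixes x :: "nat \<Rightarrow> 'e::banach_lattice"
  assumes "disjoint_seq x" "weakly_null x"
  shows "weakly_null (\<lambda>j. \<bar>x j\<bar>)"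
  unfolding weakly_null_iff
proof (intro allI impI)
  fix f :: "'e \<Rightarrow> real" assume "bounded_linear f"
  then interpret bounded_linear f .
  obtain C where C: "0 \<le> C" "\<And>v. \<bar>f v\<bar> \<le> C * norm v"
    using nonneg_bounded by (auto simp: mult.commute)
  have abs_disj: "disjoint_seq (\<lambda>j. \<bar>x j\<bar>)"
    using assms(1) by (simp add: disjoint_seq_def)
  have "(\<Sum>j<n. a j * f \<bar>x j\<bar>) \<le> C * norm (\<Sum>j<n. a j *\<^sub>R x j)" for a n
  proof -
    have "\<bar>\<Sum>j<n. a j *\<^sub>R \<bar>x j\<bar>\<bar> = \<bar>\<Sum>j<n. a j *\<^sub>R x j\<bar>"
      using abs_sum_disjoint[OF disjoint_seq_scaleR[OF abs_disj]]
        abs_sum_disjoint[OF disjoint_seq_scaleR[OF assms(1)]] by (simp add: abs_scaleR_lattice)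
    then have "norm (\<Sum>j<n. a j *\<^sub>R \<bar>x j\<bar>) = norm (\<Sum>j<n. a j *\<^sub>R x j)"
      by (metis norm_abs_eq)
    moreover have "(\<Sum>j<n. a j * f \<bar>x j\<bar>) = f (\<Sum>j<n. a j *\<^sub>R \<bar>x j\<bar>)"
      by (simp add: sum scaleR)
    ultimately show ?thesis
      using C(2)[of "\<Sum>j<n. a j *\<^sub>R \<bar>x j\<bar>"] by simp
  qed
  from this C(1) obtain \<phi> where \<phi>: "bounded_linear \<phi>" "\<And>j. \<phi> (x j) = f \<bar>x j\<bar>"
    by (rule functional_with_values) (rule that; assumption)
  have "(\<lambda>j. \<phi> (x j)) \<longlonglongrightarrow> 0"
    using assms(2) \<phi>(1) unfolding weakly_null_iff by blast
  then show "(\<lambda>j. f \<bar>x j\<bar>) \<longlonglongrightarrow> 0"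
    unfolding \<phi>(2) .
qed

section \<open>Blockwise multiples of a sequence\<close>

lemma weakly_null_bounded_multiple:
  assumes "weakly_null x" "strict_mono r" "bounded (range a)"
  shows "weakly_null (\<lambda>j. a j *\<^sub>R x (r j))"
  unfolding weakly_null_iff
proof (intro allI impI)
  fix \<phi> :: "'a \<Rightarrow> real" assume \<phi>: "bounded_linear \<phi>"
  obtain M where M: "\<And>j. \<bar>a j\<bar> \<le> M"
    using assms(3) by (auto simp: bounded_iff)
  have "(\<lambda>j. \<phi> (x j)) \<longlonglongrightarrow> 0"
    using assms(1) \<phi> unfolding weakly_null_iff by blast
  then have "(\<lambda>j. \<phi> (x (r j))) \<longlonglongrightarrow> 0"
    using LIMSEQ_subseq_LIMSEQ[OF _ assms(2)] by (auto simp: comp_def)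
  then have lim: "(\<lambda>j. M * \<bar>\<phi> (x (r j))\<bar>) \<longlonglongrightarrow> 0"
    by (intro tendsto_mult_right_zero tendsto_rabs_zero)
  have "norm (\<phi> (a j *\<^sub>R x (r j))) \<le> M * \<bar>\<phi> (x (r j))\<bar>" for j
    using M[of j] by (simp add: linear_scale[OF bounded_linear.linear[OF \<phi>]] abs_mult mult_right_mono)
  then show "(\<lambda>j. \<phi> (a j *\<^sub>R x (r j))) \<longlonglongrightarrow> 0"
    by (rule Lim_null_comparison[OF always_eventually[OF allI] lim])
qed

lemma sup_inf_scaleR_same:
  fixes v :: "'e::banach_lattice"
  assumes "0 \<le> v"
  shows "sup (a *\<^sub>R v) (b *\<^sub>R v) = max a b *\<^sub>R v" "inf (a *\<^sub>R v) (b *\<^sub>R v) = min a b *\<^sub>R v"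
proof -
  have "a *\<^sub>R v \<le> b *\<^sub>R v" if "a \<le> b" for a b
    using that assms by (rule scaleR_right_mono)
  then show "sup (a *\<^sub>R v) (b *\<^sub>R v) = max a b *\<^sub>R v" "inf (a *\<^sub>R v) (b *\<^sub>R v) = min a b *\<^sub>R v"
    by (cases "a \<le> b"; simp add: sup_absorb1 sup_absorb2 inf_absorb1 inf_absorb2)+
qed

text \<open>Any map with infinite fibres would do: a sequence of scalars spread over the blocks repeats each of
  its values infinitely often.\<close>

definition block :: "nat \<Rightarrow> nat" where
  "block j = fst (prod_decode j)"

lemma block_prod_encode [simp]: "block (prod_encode (k, m)) = k"
  by (simp add: block_def)

definition blockwise_multiple :: "(nat \<Rightarrow> 'e::banach_lattice) \<Rightarrow> (nat \<Rightarrow> real) \<Rightarrow> nat \<Rightarrow> 'e" where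
  "blockwise_multiple y c = (\<lambda>j. c (block j) *\<^sub>R y j)"

definition block_span :: "(nat \<Rightarrow> 'e::banach_lattice) \<Rightarrow> (nat \<Rightarrow> 'e) set" where
  "block_span y = blockwise_multiple y ` {c. bounded (range c)}"

lemma blockwise_multiple_in_block_span:
  "(\<And>k. \<bar>c k\<bar> \<le> M) \<Longrightarrow> blockwise_multiple y c \<in> block_span y"
  unfolding block_span_def bounded_iff by auto

lemma block_spanE:
  assumes "f \<in> block_span y"
  obtains c M where "f = blockwise_multiple y c" "\<And>k. \<bar>c k\<bar> \<le> M"
  using assms unfolding block_span_def bounded_iff by auto

lemma block_span_subset_ell_infty:
  assumes "y \<in> ell_infty"
  shows "block_span y \<subseteq> ell_infty"
proof
  fix f assume "f \<in> block_span y"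
  then obtain c M where f: "f = blockwise_multiple y c" and M: "\<And>k. \<bar>c k\<bar> \<le> M"
    by (rule block_spanE) blast
  obtain R where R: "\<And>j. norm (y j) \<le> R"
    using assms by (auto simp: ell_infty_def bounded_iff)
  have "norm (f j) \<le> M * R" for j
    unfolding f blockwise_multiple_def norm_scaleR
    using M[of "block j"] by (intro mult_mono M R) auto
  then show "f \<in> ell_infty"
    unfolding ell_infty_def bounded_iff by blast
qed

lemma subspace_block_span: "subspace (block_span y)"
  unfolding subspace_def
proof (intro conjI ballI allI)
  show "0 \<in> block_span y"
    using blockwise_multiple_in_block_span[of "\<lambda>_. 0" 0 y] by (simp add: blockwise_multiple_def zero_fun_def)
next
  fix f g assume "f \<in> block_span y" "g \<in> block_span y"
  then obtain c M d M' where fg: "f = blockwise_multiple y c" "\<And>k. \<bar>c k\<bar> \<le> M"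
      "g = blockwise_multiple y d" "\<And>k. \<bar>d k\<bar> \<le> M'"
    by (metis block_spanE)
  have "\<bar>c k + d k\<bar> \<le> M + M'" for k
    by (intro abs_triangle_ineq[THEN order_trans] add_mono fg)
  then have "blockwise_multiple y (\<lambda>k. c k + d k) \<in> block_span y"
    by (rule blockwise_multiple_in_block_span)
  then show "f + g \<in> block_span y"
    by (simp add: fg blockwise_multiple_def plus_fun_def scaleR_add_left)
next
  fix a :: real and f assume "f \<in> block_span y"
  then obtain c M where f: "f = blockwise_multiple y c" "\<And>k. \<bar>c k\<bar> \<le> M"
    by (rule block_spanE) blast
  have "\<bar>a * c k\<bar> \<le> \<bar>a\<bar> * M" for k
    unfolding abs_mult using f(2) by (intro mult_left_mono) auto
  then have "blockwise_multiple y (\<lambda>k. a * c k) \<in> block_span y"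
    by (rule blockwise_multiple_in_block_span)
  then show "a *\<^sub>R f \<in> block_span y"
    by (simp add: f blockwise_multiple_def scaleR_fun_def)
qed

lemma sup_inf_block_span:
  assumes "\<And>j. 0 \<le> y j" "f \<in> block_span y" "g \<in> block_span y"
  shows "sup f g \<in> block_span y" "inf f g \<in> block_span y"
proof -
  obtain c M d M' where fg: "f = blockwise_multiple y c" "\<And>k. \<bar>c k\<bar> \<le> M"
      "g = blockwise_multiple y d" "\<And>k. \<bar>d k\<bar> \<le> M'"
    using assms(2,3) by (metis block_spanE)
  have "\<bar>max (c k) (d k)\<bar> \<le> max M M'" "\<bar>min (c k) (d k)\<bar> \<le> max M M'" for k
    using fg(2,4)[of k] by (auto simp: max_def min_def)
  then have "blockwise_multiple y (\<lambda>k. max (c k) (d k)) \<in> block_span y"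
      "blockwise_multiple y (\<lambda>k. min (c k) (d k)) \<in> block_span y"
    by (auto intro: blockwise_multiple_in_block_span)
  then show "sup f g \<in> block_span y" "inf f g \<in> block_span y"
    by (simp_all add: fg blockwise_multiple_def sup_fun_def inf_fun_def sup_inf_scaleR_same assms(1))
qed

text \<open>The line spanned by \<open>v\<close> is complete; a functional with \<open>\<phi> v = norm v\<close> reads off the coefficient.\<close>

lemma convergent_coefficients:
  fixes v :: "'a::real_normed_vector"
  assumes "v \<noteq> 0" "(\<lambda>n. a n *\<^sub>R v) \<longlonglongrightarrow> w"
  obtains b where "a \<longlonglongrightarrow> b"
proof -
  obtain \<phi> :: "'a \<Rightarrow>\<^sub>L real" where \<phi>: "blinfun_apply \<phi> v = norm v"
    using norm_attained_by_functional by metis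
  have "(\<lambda>n. blinfun_apply \<phi> (a n *\<^sub>R v)) \<longlonglongrightarrow> blinfun_apply \<phi> w"
    by (intro tendsto_intros assms)
  then have "(\<lambda>n. a n * norm v / norm v) \<longlonglongrightarrow> blinfun_apply \<phi> w / norm v"
    using assms(1) by (intro tendsto_divide) (auto simp: blinfun.scaleR_right \<phi>)
  then show thesis
    using that assms(1) by simp
qed

text \<open>Norm limits are pointwise limits, so the multipliers converge on each block. The lower bound
\<open>\<delta>\<close> makes the limiting multiplier bounded.\<close>

lemma closed_block_span:
  assumes "y \<in> ell_infty" and "0 < \<delta>" and lower: "\<And>j. \<delta> \<le> norm (y j)"
  shows "closedin (Metric_space.mtopology ell_infty (norm_dist_on ell_infty ell_infty_norm)) (block_span y)"
proof -
  let ?d = "norm_dist_on (ell_infty :: (nat \<Rightarrow> 'a) set) ell_infty_norm"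
  interpret Metric_space "ell_infty :: (nat \<Rightarrow> 'a) set" ?d
    by (rule Metric_space_norm_dist_on[OF subspace_ell_infty norm_on_ell_infty])
  have "l \<in> block_span y"
    if range: "range \<sigma> \<subseteq> block_span y" and lim: "limitin mtopology \<sigma> l sequentially" for \<sigma> l
  proof -
    have l: "l \<in> ell_infty" and near: "\<And>e. e > 0 \<Longrightarrow> \<exists>N. \<forall>n\<ge>N. \<sigma> n \<in> ell_infty \<and> ?d (\<sigma> n) l < e"
      using lim by (auto simp: limit_metric_sequentially)
    have "\<forall>n. \<exists>c. \<sigma> n = blockwise_multiple y c"
      using range by (metis block_spanE range_subsetD)
    then obtain c where c: "\<And>n. \<sigma> n = blockwise_multiple y (c n)"
      by metis
    have pointwise: "(\<lambda>n. \<sigma> n j) \<longlonglongrightarrow> l j" for j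
    proof (rule LIMSEQ_I)
      fix e :: real assume "0 < e"
      then obtain N where N: "\<And>n. n \<ge> N \<Longrightarrow> \<sigma> n \<in> ell_infty \<and> ?d (\<sigma> n) l < e"
        using near by blast
      have "norm (\<sigma> n j - l j) < e" if "n \<ge> N" for n
      proof -
        have "\<sigma> n - l \<in> ell_infty"
          using N[OF that] l by (intro subspace_diff[OF subspace_ell_infty]) auto
        then show ?thesis
          using norm_le_ell_infty_norm[of "\<sigma> n - l" j] N[OF that] l by (auto simp: norm_dist_on_def)
      qed
      then show "\<exists>N. \<forall>n\<ge>N. norm (\<sigma> n j - l j) < e"
        by blast
    qed
    have y_nz: "y j \<noteq> 0" for j
      using lower[of j] \<open>0 < \<delta>\<close> by auto
    have "\<exists>b. (\<lambda>n. c n k) \<longlonglongrightarrow> b" for k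
    proof -
      have "(\<lambda>n. c n k *\<^sub>R y (prod_encode (k, 0))) \<longlonglongrightarrow> l (prod_encode (k, 0))"
        using pointwise[of "prod_encode (k, 0)"] by (simp add: c blockwise_multiple_def)
      with y_nz show ?thesis
        by (rule convergent_coefficients) blast
    qed
    then obtain b where b: "\<And>k. (\<lambda>n. c n k) \<longlonglongrightarrow> b k"
      by metis
    have l_eq: "l = blockwise_multiple y b"
    proof
      fix j
      have "(\<lambda>n. \<sigma> n j) \<longlonglongrightarrow> b (block j) *\<^sub>R y j"
        unfolding c blockwise_multiple_def by (intro tendsto_intros b)
      then show "l j = blockwise_multiple y b j"
        using pointwise[of j] LIMSEQ_unique by (auto simp: blockwise_multiple_def)
    qed
    obtain R where R: "\<And>j. norm (l j) \<le> R"
      using l by (auto simp: ell_infty_def bounded_iff)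
    have "\<bar>b k\<bar> \<le> R / \<delta>" for k
    proof -
      let ?j = "prod_encode (k, 0)"
      have "\<bar>b k\<bar> * \<delta> \<le> \<bar>b k\<bar> * norm (y ?j)"
        by (intro mult_left_mono lower) simp
      also have "\<dots> = norm (l ?j)"
        by (simp add: l_eq blockwise_multiple_def)
      also have "\<dots> \<le> R"
        by (rule R)
      finally show ?thesis
        using \<open>0 < \<delta>\<close> by (simp add: field_simps)
    qed
    then show ?thesis
      unfolding l_eq by (rule blockwise_multiple_in_block_span)
  qed
  then show ?thesis
    unfolding metric_closedin_iff_sequentially_closed
    using block_span_subset_ell_infty[OF assms(1)] by blast
qed

text \<open>The multiples of \<open>y\<close> supported on single blocks are linearly independent.\<close>

lemma infinite_dimensional_block_span:
  assumes nz: "\<And>j. y j \<noteq> 0"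
  shows "infinite_dimensional (block_span y)"
  unfolding infinite_dimensional_def
proof
  assume "\<exists>A. finite A \<and> span A = block_span y"
  then obtain A where A: "finite A" "span A = block_span y"
    by blast
  define e where "e k = blockwise_multiple y (\<lambda>i. if i = k then 1 else 0)" for k
  have e_same: "e k (prod_encode (k, 0)) \<noteq> 0" for k
    using nz by (simp add: e_def blockwise_multiple_def)
  have e_other: "e i (prod_encode (k, 0)) = 0" if "i \<noteq> k" for i k
    using that by (simp add: e_def blockwise_multiple_def)
  have "inj e"
    using e_same e_other by (metis injI)
  have "independent (range e)"
  proof
    assume "dependent (range e)"
    then obtain k where k: "e k \<in> span (range e - {e k})"
      unfolding dependent_def by blast
    have "subspace {f. f (prod_encode (k, 0)) = (0::'a)}"
      by (simp add: subspace_def scaleR_fun_def)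
    moreover have "range e - {e k} \<subseteq> {f. f (prod_encode (k, 0)) = 0}"
      by (auto intro!: e_other)
    ultimately have "span (range e - {e k}) \<subseteq> {f. f (prod_encode (k, 0)) = 0}"
      by (rule span_minimal[rotated])
    then show False
      using k e_same by blast
  qed
  moreover have "range e \<subseteq> span A"
    unfolding A(2) e_def by (intro image_subsetI blockwise_multiple_in_block_span[of _ 1]) auto
  ultimately have "finite (range e)"
    by (rule independent_span_bound[OF A(1), THEN conjunct1])
  then show False
    using \<open>inj e\<close> by (simp add: finite_image_iff)
qed

lemma closed_sublattice_block_span:
  assumes "y \<in> ell_infty" "\<And>j. 0 \<le> y j" "0 < \<delta>" "\<And>j. \<delta> \<le> norm (y j)"
  shows "closed_sublattice_of ell_infty ell_infty_norm (block_span y)"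
  unfolding closed_sublattice_of_def
proof (intro conjI ballI)
  show sub: "block_span y \<subseteq> ell_infty"
    using assms(1) by (rule block_span_subset_ell_infty)
  fix f g assume fg: "f \<in> block_span y" "g \<in> block_span y"
  then have "f \<in> ell_infty" "g \<in> ell_infty"
    using sub by auto
  then show "sup_in ell_infty f g \<in> block_span y" "inf_in ell_infty f g \<in> block_span y"
    using sup_inf_block_span[OF assms(2) fg]
    by (simp_all add: sup_in_eqI[OF is_sup_in_ell_infty] inf_in_eqI[OF is_inf_in_ell_infty])
qed (use assms in \<open>auto intro: subspace_block_span closed_block_span\<close>)

text \<open>A nonzero multiplier does not vanish on some block, and that block is infinite.\<close>

lemma not_null_blockwise_multiple:
  assumes "bounded_linear T" "0 < \<epsilon>" "\<And>j. \<epsilon> \<le> norm (T (y j))" "blockwise_multiple y c \<noteq> 0"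
  shows "\<not> (\<lambda>j. T (blockwise_multiple y c j)) \<longlonglongrightarrow> 0"
proof
  assume lim: "(\<lambda>j. T (blockwise_multiple y c j)) \<longlonglongrightarrow> 0"
  obtain k where k: "c k \<noteq> 0"
    using assms(4) by (fastforce simp: blockwise_multiple_def fun_eq_iff)
  have "filterlim (\<lambda>m. prod_encode (k, m)) at_top sequentially"
    by (rule filterlim_at_top_mono[OF filterlim_ident]) (simp add: le_prod_encode_2)
  then have "(\<lambda>m. T (blockwise_multiple y c (prod_encode (k, m)))) \<longlonglongrightarrow> 0"
    by (rule filterlim_compose[OF lim])
  then have "(\<lambda>m. norm (c k *\<^sub>R T (y (prod_encode (k, m))))) \<longlonglongrightarrow> 0"
    unfolding blockwise_multiple_def linear_scale[OF bounded_linear.linear[OF assms(1)]] block_prod_encode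
    by (rule tendsto_norm_zero)
  moreover have "\<bar>c k\<bar> * \<epsilon> \<le> norm (c k *\<^sub>R T (y (prod_encode (k, m))))" for m
    using assms(3) by (simp add: mult_left_mono)
  ultimately have "\<bar>c k\<bar> * \<epsilon> \<le> 0"
    by (intro tendsto_lowerbound[of _ _ sequentially]) auto
  then show False
    using k \<open>0 < \<epsilon>\<close> by (simp add: mult_le_0_iff)
qed

section \<open>Latticeability\<close>

text \<open>The sublattice is the block span of a subsequence \<open>y\<close> along which \<open>norm (T (y j))\<close>, and hence \<open>norm (y j)\<close>,
is bounded away from \<open>0\<close>. The hypothesis \<open>stable\<close> is what puts it inside the set.\<close>

lemma almost_positive_pointwise_latticeableI:
  fixes T :: "'e::banach_lattice \<Rightarrow> 'f::banach"
  assumes T: "bounded_linear T"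
    and stable: "\<And>x r a. P x \<Longrightarrow> strict_mono r \<Longrightarrow> bounded (range a) \<Longrightarrow> P (\<lambda>j. a j *\<^sub>R x (r j))"
    and witness: "\<exists>x. 0 \<le> x \<and> P x \<and> weakly_null x \<and> \<not> (\<lambda>j. T (x j)) \<longlonglongrightarrow> 0"
  shows "almost_positive_pointwise_latticeable ell_infty ell_infty_norm
           {x. P x \<and> weakly_null x \<and> \<not> (\<lambda>j. T (x j)) \<longlonglongrightarrow> 0}" (is "almost_positive_pointwise_latticeable _ _ ?B")
  unfolding almost_positive_pointwise_latticeable_def
proof (intro conjI ballI impI)
  show "banach_sequence_lattice (ell_infty :: (nat \<Rightarrow> 'e) set) ell_infty_norm"
    by (rule banach_sequence_lattice_ell_infty)
  show B: "?B \<subseteq> ell_infty"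
    using weakly_null_bounded by (auto simp: ell_infty_def)
  show "?B \<inter> {x \<in> ell_infty. 0 \<le> x} \<noteq> {}"
    using witness B by blast
  fix x assume x: "x \<in> ?B" "0 \<le> x"
  obtain \<epsilon> where "0 < \<epsilon>" and often: "\<And>N. \<exists>n\<ge>N. \<epsilon> \<le> norm (T (x n))"
    using x(1) unfolding LIMSEQ_iff by (auto simp: not_less)
  have "infinite {n. \<epsilon> \<le> norm (T (x n))}"
    unfolding infinite_nat_iff_unbounded_le using often by blast
  then obtain r :: "nat \<Rightarrow> nat" where r: "strict_mono r" "\<And>j. \<epsilon> \<le> norm (T (x (r j)))"
    using infinite_enumerate by blast
  define y where "y = x \<circ> r"
  have T_y: "\<epsilon> \<le> norm (T (y j))" for j
    using r(2) by (simp add: y_def)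
  obtain K where K: "0 < K" "\<And>v. norm (T v) \<le> norm v * K"
    using bounded_linear.pos_bounded[OF T] by blast
  have lower: "\<epsilon> / K \<le> norm (y j)" for j
    using order_trans[OF T_y K(2), of j] K(1) by (simp add: field_simps)
  have "0 < \<epsilon> / K"
    using \<open>0 < \<epsilon>\<close> K(1) by simp
  have y_pos: "0 \<le> y j" for j
    using x(2) by (simp add: y_def le_fun_def)
  have "x \<in> ell_infty"
    using x(1) B by blast
  then have "y \<in> ell_infty"
    by (auto simp: ell_infty_def y_def bounded_iff)
  show "\<exists>S. closed_sublattice_of ell_infty ell_infty_norm S \<and> infinite_dimensional S \<and> S \<subseteq> ?B \<union> {0} \<and>
             (\<exists>r::nat \<Rightarrow> nat. strict_mono r \<and> x \<circ> r \<in> S)"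
  proof (intro exI conjI)
    show "closed_sublattice_of ell_infty ell_infty_norm (block_span y)"
      using \<open>y \<in> ell_infty\<close> y_pos \<open>0 < \<epsilon> / K\<close> lower by (rule closed_sublattice_block_span)
    show "infinite_dimensional (block_span y)"
      using lower \<open>0 < \<epsilon> / K\<close> by (intro infinite_dimensional_block_span) (metis norm_zero not_less)
    show "block_span y \<subseteq> ?B \<union> {0}"
    proof
      fix f assume "f \<in> block_span y"
      then obtain c M where f: "f = blockwise_multiple y c" "\<And>k. \<bar>c k\<bar> \<le> M"
        by (rule block_spanE) blast
      have f': "f = (\<lambda>j. c (block j) *\<^sub>R x (r j))"
        by (simp add: f blockwise_multiple_def y_def)
      have "bounded (range (\<lambda>j. c (block j)))"
        unfolding bounded_iff using f(2) by auto
      then have "P f" "weakly_null f"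
        unfolding f' using x(1) r(1) stable weakly_null_bounded_multiple by blast+
      then show "f \<in> ?B \<union> {0}"
        using not_null_blockwise_multiple[of T \<epsilon> y c, OF T \<open>0 < \<epsilon>\<close> T_y] f(1) by blast
    qed
    show "strict_mono r"
      by (rule r(1))
    show "x \<circ> r \<in> block_span y"
      using blockwise_multiple_in_block_span[of "\<lambda>_. 1" 1 y] by (simp add: blockwise_multiple_def y_def comp_def)
  qed
qed

theorem corollary4p13:
  fixes T :: "'e::banach_lattice \<Rightarrow> 'f::banach"
  assumes "bounded_linear T"
  shows "(\<not> order_weakly_compact T \<longrightarrow>
            almost_positive_pointwise_latticeable ell_infty ell_infty_norm
              {x. order_bounded_seq x \<and> weakly_null x \<and> \<not> (\<lambda>j. T (x j)) \<longlonglongrightarrow> 0})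
       \<and> (\<not> almost_Dunford_Pettis T \<longrightarrow>
            almost_positive_pointwise_latticeable ell_infty ell_infty_norm
              {x. disjoint_seq x \<and> weakly_null x \<and> \<not> (\<lambda>j. T (x j)) \<longlonglongrightarrow> 0})"
proof (intro conjI impI)
  assume "\<not> order_weakly_compact T"
  then obtain z x where z: "\<And>n. 0 \<le> z n" "\<And>n. z n \<le> x" "disjoint_seq z" "\<not> (\<lambda>n. T (z n)) \<longlonglongrightarrow> 0"
    using order_weakly_compactI[OF assms] by metis
  show "almost_positive_pointwise_latticeable ell_infty ell_infty_norm
          {x. order_bounded_seq x \<and> weakly_null x \<and> \<not> (\<lambda>j. T (x j)) \<longlonglongrightarrow> 0}"
  proof (rule almost_positive_pointwise_latticeableI[OF assms])
    fix x :: "nat \<Rightarrow> 'e" and r :: "nat \<Rightarrow> nat" and a :: "nat \<Rightarrow> real"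
    assume "order_bounded_seq x" "bounded (range a)"
    obtain w where w: "\<And>j. \<bar>x j\<bar> \<le> w"
      using \<open>order_bounded_seq x\<close> by (rule order_bounded_seq_imp_abs_le) blast
    obtain M where M: "\<And>j. \<bar>a j\<bar> \<le> M"
      using \<open>bounded (range a)\<close> by (auto simp: bounded_iff)
    have "0 \<le> M"
      using M[of 0] by simp
    have "\<bar>a j *\<^sub>R x (r j)\<bar> \<le> M *\<^sub>R w" for j
      unfolding abs_scaleR_lattice using M w \<open>0 \<le> M\<close> by (intro scaleR_mono) auto
    then show "order_bounded_seq (\<lambda>j. a j *\<^sub>R x (r j))"
      by (rule order_bounded_seqI)
  next
    have abs_le: "\<bar>z n\<bar> \<le> x" for n
      using z(1,2) by (simp add: abs_of_nonneg)
    have "order_bounded_seq z" "weakly_null z"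
      using order_bounded_seqI[OF abs_le] disjoint_order_bounded_weakly_null[OF z(3) abs_le] by auto
    then show "\<exists>x. 0 \<le> x \<and> order_bounded_seq x \<and> weakly_null x \<and> \<not> (\<lambda>j. T (x j)) \<longlonglongrightarrow> 0"
      using z(1,4) by (intro exI[of _ z]) (auto simp: le_fun_def)
  qed
next
  assume "\<not> almost_Dunford_Pettis T"
  then obtain x where x: "disjoint_seq x" "weakly_null x" "\<not> (\<lambda>j. T (x j)) \<longlonglongrightarrow> 0"
    unfolding almost_Dunford_Pettis_def by blast
  \<comment> \<open>\<open>part 1\<close> and \<open>part (- 1)\<close> are the positive and the negative parts.\<close>
  define part where "part s = (\<lambda>j. pprt (s *\<^sub>R x j))" for s :: real
  show "almost_positive_pointwise_latticeable ell_infty ell_infty_norm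
          {x. disjoint_seq x \<and> weakly_null x \<and> \<not> (\<lambda>j. T (x j)) \<longlonglongrightarrow> 0}"
  proof (rule almost_positive_pointwise_latticeableI[OF assms])
    fix x :: "nat \<Rightarrow> 'e" and r :: "nat \<Rightarrow> nat" and a :: "nat \<Rightarrow> real"
    assume "disjoint_seq x" "strict_mono r"
    then have "disjoint_seq (\<lambda>j. x (r j))"
      by (auto simp: disjoint_seq_def strict_mono_eq)
    then show "disjoint_seq (\<lambda>j. a j *\<^sub>R x (r j))"
      by (rule disjoint_seq_scaleR)
  next
    have parts: "disjoint_seq (part s)" "weakly_null (part s)" "0 \<le> part s" if "s = 1 \<or> s = -1" for s
    proof -
      have abs_eq: "\<bar>v\<bar> = 2 *\<^sub>R pprt (s *\<^sub>R v) - s *\<^sub>R v" for v :: 'e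
        using that prts[of v] by (auto simp: abs_prts pprt_neg scaleR_2 algebra_simps)
      have le: "pprt (s *\<^sub>R x j) \<le> \<bar>x j\<bar>" for j
        using that by (intro pprt_le) (auto simp: abs_ge_self abs_ge_minus_self)
      show "disjoint_seq (part s)"
        unfolding disjoint_seq_def part_def abs_of_nonneg[OF zero_le_pprt]
        using x(1) inf_mono_eq_0[OF _ zero_le_pprt le zero_le_pprt le] by (simp add: disjoint_seq_def)
      show "0 \<le> part s"
        by (simp add: part_def le_fun_def)
      have part_eq: "part s j = (1 / 2) *\<^sub>R \<bar>x j\<bar> + (s / 2) *\<^sub>R x j" for j
        by (simp add: abs_eq part_def scaleR_diff_right)
      show "weakly_null (part s)"
        unfolding weakly_null_iff
      proof (intro allI impI)
        fix \<phi> :: "'e \<Rightarrow> real" assume \<phi>: "bounded_linear \<phi>"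
        have "(\<lambda>j. \<phi> \<bar>x j\<bar>) \<longlonglongrightarrow> 0" "(\<lambda>j. \<phi> (x j)) \<longlonglongrightarrow> 0"
          using disjoint_weakly_null_abs[OF x(1,2)] x(2) \<phi> unfolding weakly_null_iff by blast+
        then have "(\<lambda>j. (1 / 2) * \<phi> \<bar>x j\<bar> + (s / 2) * \<phi> (x j)) \<longlonglongrightarrow> (1 / 2) * 0 + (s / 2) * 0"
          by (intro tendsto_intros)
        then show "(\<lambda>j. \<phi> (part s j)) \<longlonglongrightarrow> 0"
          unfolding part_eq by (simp add: linear_add[OF bounded_linear.linear[OF \<phi>]]
              linear_scale[OF bounded_linear.linear[OF \<phi>]])
      qed
    qed
    have "\<not> (\<lambda>j. T (part 1 j)) \<longlonglongrightarrow> 0 \<or> \<not> (\<lambda>j. T (part (- 1) j)) \<longlonglongrightarrow> 0"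
    proof (rule ccontr)
      assume "\<not> ?thesis"
      then have "(\<lambda>j. T (part 1 j) - T (part (- 1) j)) \<longlonglongrightarrow> 0 - 0"
        by (intro tendsto_diff) auto
      moreover have "x j = part 1 j - part (- 1) j" for j
        using prts[of "x j"] by (simp add: part_def pprt_neg)
      ultimately show False
        using x(3) linear_diff[OF bounded_linear.linear[OF assms]] by simp
    qed
    then show "\<exists>x. 0 \<le> x \<and> disjoint_seq x \<and> weakly_null x \<and> \<not> (\<lambda>j. T (x j)) \<longlonglongrightarrow> 0"
      using parts by blast
  qed
qed

end
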